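(* Let $\alpha\in[\frac12,1]$ and $\lambda>0$. There is a constant $c_{\alpha,\lambda}>0$ depending only on $\alpha,\lambda$ such that the following holds. Let $K\in\mathbb N$, $\delta=1/K$, $\tau>0$, and let $(\tau_n)_{n\ge1}$ be time steps with $\tau_n\in(0,\tau]$, $t_n=\sum_{j=1}^n\tau_j$. Let $(\vec{\mathrm x}_\Delta^n)_{n\ge0}$ be any sequence in $\mathfrak x_\delta$ such that for each $n\ge1$ the vector $\vec{\mathrm x}_\Delta^n$ is a global minimizer over $\mathfrak x_\delta$ of $$\vec{\mathrm x}\mapsto \frac{1}{2\tau_n}\|\vec{\mathrm x}-\vec{\mathrm x}_\Delta^{n-1}\|_\delta^2+\mathbf F_{\alpha,\lambda}(\vec{\mathrm x}).$$ Let $\vec{\mathrm x}_\delta^{\min}$ be the unique minimizer of $\mathbf H_{\alpha,\lambda}$ on $\mathfrak x_\delta$, $\mathbf H^{\min}_{\alpha,\lambda}=\mathbf H_{\alpha,\lambda}(\vec{\mathrm x}_\delta^{\min})$, $\mathbf F^{\min}_{\alpha,\lambda}=\mathbf F_{\alpha,\lambda}(\vec{\mathrm x}_\delta^{\min})$, $u_\Delta^n=\mathbf u_\delta[\vec{\mathrm x}_\Delta^n]$ and $u_\delta^{\min}=\mathbf u_\delta[\vec{\mathrm x}_\delta^{\min}]$. Then for every $n=1,2,\dots$: $$\mathbf H_{\alpha,\lambda}(\vec{\mathrm x}_\Delta^n)-\mathbf H^{\min}_{\alpha,\lambda}\le\big(\mathbf H_{\alpha,\lambda}(\vec{\mathrm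 x}_\Delta^0)-\mathbf H^{\min}_{\alpha,\lambda}\big)e^{-\frac{2\lambda}{1+\lambda\tau}t_n},$$ $$\mathbf F_{\alpha,\lambda}(\vec{\mathrm x}_\Delta^n)-\mathbf F^{\min}_{\alpha,\lambda}\le\big(\mathbf F_{\alpha,\lambda}(\vec{\mathrm x}_\Delta^0)-\mathbf F^{\min}_{\alpha,\lambda}\big)e^{-\frac{2\lambda}{1+\lambda\tau}t_n},$$ $$\|u_\Delta^n-u_\delta^{\min}\|_{L^1(\mathbb R)}^2\le c_{\alpha,\lambda}\big(\mathbf H_{\alpha,\lambda}(\vec{\mathrm x}_\Delta^0)-\mathbf H^{\min}_{\alpha,\lambda}\big)e^{-\frac{2\lambda}{1+\lambda\tau}t_n}.$$
   Context: For $K\in\mathbb N$ put $\delta=1/K$ (the total mass is $M=1$). Let $\mathfrak x_\delta=\{\vec{\mathrm x}=(x_0,\dots,x_K)\in\mathbb R^{K+1}: x_0<x_1<\dots<x_K\}$. For $\vec{\mathrm x}\in\mathfrak x_\delta$ set $z_{k-\frac12}=\delta/(x_k-x_{k-1})$ for $k=1,\dots,K$ and $z_{-\frac12}=z_{K+\frac12}=0$, and let $\mathbf u_\delta[\vec{\mathrm x}](x)=\sum_{k=1}^K \frac{\delta}{x_k-x_{k-1}}\mathbf 1_{(x_{k-1},x_k]}(x)$, $x\in\mathbb R$. On $\mathbb R^{K+1}$ use the norm $\|\vec{\mathrm v}\|_\delta=\big(\delta\sum_{k=0}^K v_k^2\big)^{1/2}$. Constants: $\Theta_\alpha=\sqrt{2\alpha}/(2\alpha+1)$,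 $\Lambda_{\alpha,\lambda}=\sqrt{\lambda/(2\alpha+1)}$. Let $f_\alpha(s)=\Theta_\alpha\frac{s^{\alpha-1/2}}{\alpha-1/2}$ for $\alpha\in(\frac12,1]$ and $f_{1/2}(s)=\Theta_{1/2}\ln s$. The discrete entropy and discrete perturbed information functional on $\mathfrak x_\delta$ are $$\mathbf H_{\alpha,\lambda}(\vec{\mathrm x})=\delta\sum_{k=1}^K f_\alpha(z_{k-\frac12})+\frac{\Lambda_{\alpha,\lambda}}2\|\vec{\mathrm x}\|_\delta^2,\qquad \mathbf F_{\alpha,\lambda}(\vec{\mathrm x})=\Theta_\alpha^2\,\delta\sum_{k=0}^K\left(\frac{z_{k+\frac12}^{\alpha+\frac12}-z_{k-\frac12}^{\alpha+\frac12}}{\delta}\right)^2+\frac\lambda2\|\vec{\mathrm x}\|_\delta^2.$$ For $\lambda>0$, $\mathbf H_{\alpha,\lambda}$ has a unique minimizer in $\mathfrak x_\delta$. *)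

theory Defs
  imports "HOL-Analysis.Analysis"
begin

definition mesh :: "nat \<Rightarrow> real" where
  "mesh K = 1 / real K"

text \<open>A vector \<open>(x\<^sub>0, \<dots>, x\<^sub>K)\<close> is a function on \<open>{0..K}\<close>, extensional so that
  equality of vectors is equality in HOL (needed for uniqueness of the minimizer below).\<close>

definition grids :: "nat \<Rightarrow> (nat \<Rightarrow> real) set" where
  "grids K = {x \<in> {0..K} \<rightarrow>\<^sub>E UNIV. strict_mono_on {0..K} x}"

definition norm_mesh :: "nat \<Rightarrow> (nat \<Rightarrow> real) \<Rightarrow> real" where
  "norm_mesh K v = sqrt (mesh K * (\<Sum>k=0..K. (v k)\<^sup>2))"

text \<open>\<open>dens K x k\<close> is \<open>z\<close> with the half-integer index \<open>k - 1/2\<close>, for \<open>k = 0, \<dots>, K + 1\<close>;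
  it vanishes at the two boundary indices \<open>- 1/2\<close> and \<open>K + 1/2\<close>.\<close>

definition dens :: "nat \<Rightarrow> (nat \<Rightarrow> real) \<Rightarrow> nat \<Rightarrow> real" where
  "dens K x k = (if 1 \<le> k \<and> k \<le> K then mesh K / (x k - x (k - 1)) else 0)"

definition dens_fun :: "nat \<Rightarrow> (nat \<Rightarrow> real) \<Rightarrow> real \<Rightarrow> real" where
  "dens_fun K x y = (\<Sum>k=1..K. mesh K / (x k - x (k - 1)) * indicator {x (k - 1)<..x k} y)"

definition Theta :: "real \<Rightarrow> real" where
  "Theta \<alpha> = sqrt (2 * \<alpha>) / (2 * \<alpha> + 1)"

definition Lambda :: "real \<Rightarrow> real \<Rightarrow> real" where
  "Lambda \<alpha> lam = sqrt (lam / (2 * \<alpha> + 1))"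

definition entropy_fun :: "real \<Rightarrow> real \<Rightarrow> real" where
  "entropy_fun \<alpha> s =
     (if \<alpha> = 1/2 then Theta \<alpha> * ln s else Theta \<alpha> * (s powr (\<alpha> - 1/2) / (\<alpha> - 1/2)))"

definition entropy :: "real \<Rightarrow> real \<Rightarrow> nat \<Rightarrow> (nat \<Rightarrow> real) \<Rightarrow> real" where
  "entropy \<alpha> lam K x =
     mesh K * (\<Sum>k=1..K. entropy_fun \<alpha> (dens K x k)) + Lambda \<alpha> lam / 2 * (norm_mesh K x)\<^sup>2"

definition information :: "real \<Rightarrow> real \<Rightarrow> nat \<Rightarrow> (nat \<Rightarrow> real) \<Rightarrow> real" where
  "information \<alpha> lam K x =
     (Theta \<alpha>)\<^sup>2 * mesh K *
       (\<Sum>k=0..K. ((dens K x (k + 1) powr (\<alpha> + 1/2) - dens K x k powr (\<alpha> + 1/2)) / mesh K)\<^sup>2)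
     + lam / 2 * (norm_mesh K x)\<^sup>2"

definition is_minimizer :: "nat \<Rightarrow> ((nat \<Rightarrow> real) \<Rightarrow> real) \<Rightarrow> (nat \<Rightarrow> real) \<Rightarrow> bool" where
  "is_minimizer K f = is_arg_min f (\<lambda>x. x \<in> grids K)"

definition x_min :: "real \<Rightarrow> real \<Rightarrow> nat \<Rightarrow> nat \<Rightarrow> real" where
  "x_min \<alpha> lam K = (THE x. is_minimizer K (entropy \<alpha> lam K) x)"

definition step_functional ::
    "real \<Rightarrow> real \<Rightarrow> nat \<Rightarrow> real \<Rightarrow> (nat \<Rightarrow> real) \<Rightarrow> (nat \<Rightarrow> real) \<Rightarrow> real" where
  "step_functional \<alpha> lam K \<tau> y x =
     1 / (2 * \<tau>) * (norm_mesh K (\<lambda>k. x k - y k))\<^sup>2 + information \<alpha> lam K x"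

end

theory Submission
  imports Defs
begin

text \<open>
Write \<open>g\<close> for the gradient of the entropy \<open>H\<close> with respect to the mesh inner product, \<open>|\<cdot>|\<close> for the
mesh norm, \<open>\<Lambda> = Lambda \<alpha> lam\<close>, and let \<open>F\<close> be the information. As a function of a cell width the
entropy integrand is convex, so \<open>H\<close> is \<open>\<Lambda>\<close>-convex (\<open>entropy_strong_convexity\<close>). Expanding the square and
summing by parts gives \<open>F = |g|\<^sup>2 + (2\<alpha> - 1) \<Lambda> H + const\<close> (\<open>information_eq\<close>), so \<open>F\<close> is determined by the
convex functional \<open>H\<close>, although \<open>F\<close> itself need not be convex.

Strong convexity makes both \<open>|g|\<^sup>2\<close> and \<open>H\<close> grow along the direction \<open>g\<close>, hence \<open>F\<close> grows at rate at least
\<open>(2\<alpha> + 1) \<Lambda> |g|\<^sup>2\<close> (\<open>information_growth\<close>). Varying a minimizer \<open>x\<close> of \<open>F + |\<cdot> - y|\<^sup>2 / (2\<tau>)\<close> in that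
direction yields \<open>\<langle>g, y - x\<rangle> \<ge> \<tau> (2\<alpha> + 1) \<Lambda> |g|\<^sup>2\<close> (\<open>first_variation\<close>). The same argument without the
quadratic term shows \<open>g = 0\<close> at a minimizer of \<open>F\<close>; such a point exists by coercivity
(\<open>proximal_minimizer_exists\<close>) and is the unique minimizer of \<open>H\<close>.

Convexity of \<open>H\<close>, the bound \<open>2 \<Lambda> (H - Hmin) \<le> |g|\<^sup>2\<close> and \<open>(2\<alpha> + 1) \<Lambda>\<^sup>2 = lam\<close> turn the first variation into
\<open>(1 + 2 lam \<tau>) (H(x) - Hmin) \<le> H(y) - Hmin\<close>. For \<open>F\<close>, comparing the values at \<open>x\<close> and \<open>y\<close> alone loses a
factor 2 in the rate. De Giorgi's interpolation recovers it: one follows the minimal value of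
\<open>F + |\<cdot> - y|\<^sup>2 / (2\<sigma>)\<close> as \<open>\<sigma>\<close> runs through \<open>(0, \<tau>]\<close> (\<open>de_giorgi_interpolation\<close>). Since
\<open>1 + 2a \<ge> exp (2a / (1 + a))\<close>, iteration gives the exponential rate (\<open>discrete_decay\<close>).

For the distance in \<open>L\<^sup>1\<close>, compare both densities with the auxiliary function that has the cell values of the
minimizer on the cells of the other grid. The two differences are controlled by the Bregman part and by the
quadratic part of the entropy gap (\<open>dens_fun_L1_le\<close>), with constants that depend on \<open>K\<close> only through two weighted
sums over the minimizing grid. These are bounded uniformly in \<open>K\<close> (\<open>critical_weights_bounded\<close>): for \<open>\<alpha> = 1/2\<close>
by the second moment of the grid, and for \<open>\<alpha> > 1/2\<close> because the minimizing grids stay in a fixed interval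
(\<open>critical_bounded\<close>), which is the discrete form of the compact support of a Barenblatt profile.
\<close>

section \<open>Grid vectors and the mesh inner product\<close>

definition mesh_inner :: "nat \<Rightarrow> (nat \<Rightarrow> real) \<Rightarrow> (nat \<Rightarrow> real) \<Rightarrow> real" where
  "mesh_inner K v w = mesh K * (\<Sum>k=0..K. v k * w k)"

text \<open>Gradient of the entropy for the inner product \<open>mesh_inner K\<close>. The first term comes from the derivative
of the entropy integrand with respect to a cell width \<open>d\<close>, which is a multiple of \<open>d powr -(\<alpha> + 1/2)\<close>
for every \<open>\<alpha>\<close>, so the logarithmic case needs no separate formula.\<close>

definition entropy_grad :: "real \<Rightarrow> real \<Rightarrow> nat \<Rightarrow> (nat \<Rightarrow> real) \<Rightarrow> nat \<Rightarrow> real" where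
  "entropy_grad \<alpha> lam K x k =
     Theta \<alpha> * ((dens K x (k + 1) powr (\<alpha> + 1/2) - dens K x k powr (\<alpha> + 1/2)) / mesh K)
     + Lambda \<alpha> lam * x k"

lemma mesh_pos: "1 \<le> K \<Longrightarrow> 0 < mesh K"
  by (simp add: mesh_def)

lemma mesh_times: "1 \<le> K \<Longrightarrow> mesh K * real K = 1"
  by (simp add: mesh_def)

lemma norm_mesh_square: "(norm_mesh K v)\<^sup>2 = mesh_inner K v v"
  by (simp add: norm_mesh_def mesh_inner_def mesh_def sum_nonneg power2_eq_square)

lemma mesh_inner_nonneg: "0 \<le> mesh_inner K v v"
  by (metis norm_mesh_square zero_le_power2)

lemma mesh_inner_cong:
  "\<lbrakk>\<And>k. k \<le> K \<Longrightarrow> v k = v' k; \<And>k. k \<le> K \<Longrightarrow> w k = w' k\<rbrakk> \<Longrightarrow> mesh_inner K v w = mesh_inner K v' w'"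
  unfolding mesh_inner_def by (intro arg_cong2[where f="(*)"] sum.cong) auto

lemma mesh_inner_cauchy: "(mesh_inner K v w)\<^sup>2 \<le> mesh_inner K v v * mesh_inner K w w"
proof -
  have "(\<Sum>k=0..K. v k * w k)\<^sup>2 \<le> (\<Sum>k=0..K. (v k)\<^sup>2) * (\<Sum>k=0..K. (w k)\<^sup>2)"
    by (rule Cauchy_Schwarz_ineq_sum)
  then have "(mesh K)\<^sup>2 * (\<Sum>k=0..K. v k * w k)\<^sup>2
    \<le> (mesh K)\<^sup>2 * ((\<Sum>k=0..K. (v k)\<^sup>2) * (\<Sum>k=0..K. (w k)\<^sup>2))"
    by (rule mult_left_mono) simp
  then show ?thesis
    by (simp add: mesh_inner_def power_mult_distrib power2_eq_square mult_ac)
qed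

lemma mesh_inner_zero: "1 \<le> K \<Longrightarrow> mesh_inner K v v \<le> 0 \<Longrightarrow> k \<le> K \<Longrightarrow> v k = 0"
proof -
  assume K: "1 \<le> K" and le: "mesh_inner K v v \<le> 0" and k: "k \<le> K"
  have "(\<Sum>k=0..K. v k * v k) \<le> 0"
    using le mesh_pos[OF K] by (simp add: mesh_inner_def mult_le_0_iff)
  moreover have "(\<Sum>k=0..K. v k * v k) \<ge> 0" by (simp add: sum_nonneg)
  ultimately have "(\<Sum>k=0..K. v k * v k) = 0" by linarith
  then show "v k = 0" using k by (simp add: sum_nonneg_eq_0_iff)
qed

lemma mesh_inner_commute: "mesh_inner K v w = mesh_inner K w v"
  by (simp add: mesh_inner_def mult.commute)

lemma mesh_inner_diff_left: "mesh_inner K (\<lambda>k. v k - w k) u = mesh_inner K v u - mesh_inner K w u"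
  by (simp add: mesh_inner_def algebra_simps sum_subtractf)

lemma mesh_inner_diff_right: "mesh_inner K u (\<lambda>k. v k - w k) = mesh_inner K u v - mesh_inner K u w"
  by (simp add: mesh_inner_def algebra_simps sum_subtractf)

lemma mesh_inner_square_add:
  "mesh_inner K (\<lambda>k. v k + c * w k) (\<lambda>k. v k + c * w k) = mesh_inner K v v + 2 * c * mesh_inner K v w + c\<^sup>2 * mesh_inner K w w"
  by (simp add: mesh_inner_def algebra_simps sum.distrib sum_distrib_left power2_eq_square)

text \<open>Both boundary terms vanish, as they do for the densities, which are zero at the two outer indices.\<close>

lemma summation_by_parts:
  fixes a v :: "nat \<Rightarrow> real"
  assumes "a 0 = 0" and "a (K + 1) = 0"
  shows "(\<Sum>k=1..K. a k * (v k - v (k - 1))) = - (\<Sum>k=0..K. (a (k + 1) - a k) * v k)"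
proof -
  have "(\<Sum>k=1..K. a k * (v k - v (k - 1)))
      = a (K + 1) * v K - a 0 * v 0 - (\<Sum>k=0..K. (a (k + 1) - a k) * v k)"
    by (induction K) (auto simp: algebra_simps)
  then show ?thesis using assms by simp
qed

lemma grid_step: fixes x :: "nat \<Rightarrow> real" shows "strict_mono_on {0..K} x \<Longrightarrow> k \<in> {1..K} \<Longrightarrow> 0 < x k - x (k - 1)"
  using strict_mono_onD[of "{0..K}" x "k - 1" k] by auto

lemma strict_mono_on_if_steps:
  fixes x :: "nat \<Rightarrow> real"
  assumes "\<And>k. k \<in> {1..K} \<Longrightarrow> x (k - 1) < x k"
  shows "strict_mono_on {0..K} x"
proof -
  have "x r < x s" if "s \<le> K" "r < s" for r s
    using that
  proof (induction s)
    case (Suc s)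
    have "x s < x (Suc s)" using assms[of "Suc s"] Suc.prems by simp
    then show ?case using Suc by (cases "r = s") auto
  qed simp
  then show ?thesis by (auto simp: strict_mono_on_def)
qed

lemma dens_boundary [simp]: "dens K x 0 = 0" "dens K x (Suc K) = 0"
  by (simp_all add: dens_def)

lemma dens_eq: "k \<in> {1..K} \<Longrightarrow> dens K x k = mesh K / (x k - x (k - 1))"
  by (simp add: dens_def)

lemma dens_pos: "strict_mono_on {0..K} x \<Longrightarrow> k \<in> {1..K} \<Longrightarrow> 0 < dens K x k"
  using grid_step[of K x k] mesh_pos[of K] by (auto simp: dens_eq)

lemma dens_nonneg: "strict_mono_on {0..K} x \<Longrightarrow> 0 \<le> dens K x k"
  using dens_pos[of K x k] by (cases "k \<in> {1..K}") (auto simp: dens_def)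

lemma dens_times_step: "strict_mono_on {0..K} x \<Longrightarrow> k \<in> {1..K} \<Longrightarrow>
    dens K x k * (x k - x (k - 1)) = mesh K"
  using grid_step[of K x k] by (auto simp: dens_eq)

lemma dens_cong: "(\<And>k. k \<le> K \<Longrightarrow> x k = y k) \<Longrightarrow> dens K x k = dens K y k"
  by (auto simp: dens_def)

section \<open>The entropy: strong convexity, gradient, and the information functional\<close>

lemma powr_plus_half: "0 < (s::real) \<Longrightarrow> s powr (a + 1/2) = s powr (a - 1/2) * s"
  using powr_add[of s "a - 1/2" 1] by (simp add: add.commute)

lemma Theta_pos: "0 < \<alpha> \<Longrightarrow> 0 < Theta \<alpha>"
  by (simp add: Theta_def)

lemma Lambda_pos: "0 < \<alpha> \<Longrightarrow> 0 < lam \<Longrightarrow> 0 < Lambda \<alpha> lam"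
  by (simp add: Lambda_def)

lemma Lambda_sq: "0 < \<alpha> \<Longrightarrow> 0 < lam \<Longrightarrow> (2 * \<alpha> + 1) * (Lambda \<alpha> lam)\<^sup>2 = lam"
  by (simp add: Lambda_def)

text \<open>The entropy integrand is a convex function of the cell width, and its Bregman distance is quadratic
where the width has shrunk. With \<open>r = t / s\<close> the ratio of the widths, everything
reduces to the logarithmic case: \<open>(r powr -b - 1) / b \<ge> - ln r\<close> for \<open>b > 0\<close>, and
\<open>r - 1 - ln r\<close> dominates half the square of \<open>max 0 (1 - r)\<close>.\<close>

lemma entropy_fun_bregman:
  assumes \<alpha>: "1/2 \<le> \<alpha>" and s: "0 < s" and t: "0 < t"
  shows "entropy_fun \<alpha> t - Theta \<alpha> * t powr (\<alpha> - 1/2) * (t / s - 1)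
           + Theta \<alpha> / 2 * (t powr (\<alpha> - 1/2) * (max 0 (1 - t / s))\<^sup>2)
         \<le> entropy_fun \<alpha> s"
proof -
  define r where "r = t / s"
  have r: "0 < r" using s t by (simp add: r_def)
  have log: "(max 0 (1 - r))\<^sup>2 / 2 \<le> r - 1 - ln r"
  proof (cases "r < 1")
    case False
    then show ?thesis using ln_le_minus_one[OF r] by simp
  next
    case True
    have "(1 - r)\<^sup>2 / 2 \<le> 2 * (1 - r) / (r + 1) - (1 - r)"
    proof -
      have "2 * (1 - r) / (r + 1) - (1 - r) = (1 - r)\<^sup>2 / (1 + r)"
        using r by (simp add: field_simps power2_eq_square)
      moreover have "(1 - r)\<^sup>2 / 2 \<le> (1 - r)\<^sup>2 / (1 + r)"
        using r True by (intro divide_left_mono) auto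
      ultimately show ?thesis by simp
    qed
    also have "\<dots> \<le> - ln r - (1 - r)"
      using ln_inverse_approx_ge[of r 1] r True by simp
    finally show ?thesis using True by simp
  qed
  have t_eq: "t = r * s" using s by (simp add: r_def)
  have lnr: "ln r = ln t - ln s" using s t by (simp add: r_def ln_div)
  have "Theta \<alpha> * (t powr (\<alpha> - 1/2) * (- ln r)) \<le> entropy_fun \<alpha> s - entropy_fun \<alpha> t"
  proof (cases "\<alpha> = 1/2")
    case True
    then have "\<alpha> - 1/2 = 0" by simp
    then show ?thesis using t True by (simp only: entropy_fun_def lnr powr_zero_eq_one) (simp add: algebra_simps)
  next
    case False
    define b where "b = \<alpha> - 1/2"
    have b: "b > 0" using False \<alpha> by (simp add: b_def)
    have "1 + (- b * ln r) \<le> exp (- b * ln r)" by (rule exp_ge_add_one_self)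
    also have "\<dots> = r powr - b" using r by (simp add: powr_def)
    finally have "b * (- ln r) \<le> r powr - b - 1" by simp
    then have "- ln r \<le> (r powr - b - 1) / b"
      using b by (simp add: field_simps)
    then have "t powr b * (- ln r) \<le> t powr b * ((r powr - b - 1) / b)"
      by (rule mult_left_mono) simp
    also have "\<dots> = (s powr b - t powr b) / b"
    proof -
      have "t powr b * r powr - b = s powr b"
        using r s by (simp add: t_eq powr_mult powr_minus)
      then show ?thesis using b by (simp add: field_simps)
    qed
    finally have "Theta \<alpha> * (t powr b * (- ln r)) \<le> Theta \<alpha> * ((s powr b - t powr b) / b)"
      using Theta_pos[of \<alpha>] \<alpha> by (intro mult_left_mono) auto
    then show ?thesis using False
      by (simp add: entropy_fun_def b_def diff_divide_distrib right_diff_distrib)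
  qed
  moreover have "Theta \<alpha> * t powr (\<alpha> - 1/2) * ((max 0 (1 - r))\<^sup>2 / 2)
      \<le> Theta \<alpha> * t powr (\<alpha> - 1/2) * (r - 1 - ln r)"
    using log Theta_pos[of \<alpha>] \<alpha> by (intro mult_left_mono) auto
  ultimately show ?thesis
    by (simp add: r_def[symmetric] algebra_simps)
qed

locale admissible_parameters =
  fixes \<alpha> lam :: real
  assumes \<alpha>1: "1/2 \<le> \<alpha>" and \<alpha>2: "\<alpha> \<le> 1" and lam: "0 < lam"
begin

abbreviation (input) "H \<equiv> entropy \<alpha> lam"
abbreviation (input) "F \<equiv> information \<alpha> lam"
abbreviation (input) "g \<equiv> entropy_grad \<alpha> lam"

text \<open>Summing \<open>entropy_fun_bregman\<close> over the cells, the linear terms assemble to the entropy gradient by summation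
by parts; the moment term contributes its exact quadratic remainder. The last summand on the left
is what later controls the cell values of the densities.\<close>

lemma entropy_strong_convexity:
  assumes K: "1 \<le> K" and x: "strict_mono_on {0..K} x" and y: "strict_mono_on {0..K} y"
  shows "H K x + mesh_inner K (g K x) (\<lambda>k. y k - x k) + Lambda \<alpha> lam / 2 * mesh_inner K (\<lambda>k. y k - x k) (\<lambda>k. y k - x k)
     + Theta \<alpha> / 2 * (mesh K * (\<Sum>k=1..K. dens K x k powr (\<alpha> - 1/2) * (max 0 (1 - dens K x k / dens K y k))\<^sup>2))
     \<le> H K y"
proof -
  let ?w = "\<lambda>k. dens K x k powr (\<alpha> + 1/2)"
  let ?v = "\<lambda>k. y k - x k"
  have d: "mesh K > 0" using K by (rule mesh_pos)
  have lin: "mesh K * (Theta \<alpha> * dens K x k powr (\<alpha> - 1/2) * (dens K x k / dens K y k - 1))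
      = Theta \<alpha> * (?w k * (?v k - ?v (k - 1)))" if k: "k \<in> {1..K}" for k
  proof -
    have "dens K x k powr (\<alpha> + 1/2) = dens K x k powr (\<alpha> - 1/2) * dens K x k"
      by (rule powr_plus_half[OF dens_pos[OF x k]])
    moreover have "mesh K * (dens K x k / dens K y k - 1) = dens K x k * (?v k - ?v (k - 1))"
      using grid_step[OF x k] grid_step[OF y k] d k by (simp add: dens_eq field_simps)
    ultimately show ?thesis by (metis mult.assoc mult.left_commute)
  qed
  let ?r = "\<lambda>k. Theta \<alpha> / 2 * (dens K x k powr (\<alpha> - 1/2) * (max 0 (1 - dens K x k / dens K y k))\<^sup>2)"
  have "(\<Sum>k=1..K. mesh K * (entropy_fun \<alpha> (dens K x k)
        - Theta \<alpha> * dens K x k powr (\<alpha> - 1/2) * (dens K x k / dens K y k - 1) + ?r k))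
     \<le> (\<Sum>k=1..K. mesh K * entropy_fun \<alpha> (dens K y k))"
    using d by (intro sum_mono mult_left_mono entropy_fun_bregman \<alpha>1 dens_pos x y) auto
  also have "(\<Sum>k=1..K. mesh K * (entropy_fun \<alpha> (dens K x k)
        - Theta \<alpha> * dens K x k powr (\<alpha> - 1/2) * (dens K x k / dens K y k - 1) + ?r k))
    = (\<Sum>k=1..K. mesh K * entropy_fun \<alpha> (dens K x k) - Theta \<alpha> * (?w k * (?v k - ?v (k - 1))) + mesh K * ?r k)"
    by (intro sum.cong refl, subst lin[symmetric]) (auto simp: algebra_simps)
  also have "\<dots> = (\<Sum>k=1..K. mesh K * entropy_fun \<alpha> (dens K x k))
     - Theta \<alpha> * (\<Sum>k=1..K. ?w k * (?v k - ?v (k - 1))) + (\<Sum>k=1..K. mesh K * ?r k)"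
    by (simp add: sum.distrib sum_subtractf sum_distrib_left del: sum.cong)
  also have "(\<Sum>k=1..K. ?w k * (?v k - ?v (k - 1))) = - (\<Sum>k=0..K. (?w (k + 1) - ?w k) * ?v k)"
    by (rule summation_by_parts) auto
  also have "Theta \<alpha> * - (\<Sum>k=0..K. (?w (k + 1) - ?w k) * ?v k)
     = Lambda \<alpha> lam * mesh_inner K x ?v - mesh_inner K (g K x) ?v"
    using d by (simp add: mesh_inner_def entropy_grad_def sum_distrib_left sum.distrib algebra_simps
        diff_divide_distrib flip: sum_subtractf sum_negf)
  finally have *: "(\<Sum>k=1..K. mesh K * entropy_fun \<alpha> (dens K x k))
     - (Lambda \<alpha> lam * mesh_inner K x ?v - mesh_inner K (g K x) ?v) + (\<Sum>k=1..K. mesh K * ?r k)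
     \<le> (\<Sum>k=1..K. mesh K * entropy_fun \<alpha> (dens K y k))" .
  have sq: "Lambda \<alpha> lam / 2 * mesh_inner K y y = Lambda \<alpha> lam / 2 * mesh_inner K x x + Lambda \<alpha> lam * mesh_inner K x ?v + Lambda \<alpha> lam / 2 * mesh_inner K ?v ?v"
    by (simp add: mesh_inner_diff_left mesh_inner_diff_right mesh_inner_commute[of K y x] algebra_simps)
  have r: "(\<Sum>k=1..K. mesh K * ?r k) = Theta \<alpha> / 2 * (mesh K * (\<Sum>k=1..K. dens K x k powr (\<alpha> - 1/2) * (max 0 (1 - dens K x k / dens K y k))\<^sup>2))"
    by (simp add: sum_distrib_left mult_ac)
  show ?thesis using * sq r unfolding entropy_def norm_mesh_square sum_distrib_left[symmetric]
    by linarith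
qed

lemma entropy_convex:
  assumes "1 \<le> K" "strict_mono_on {0..K} x" "strict_mono_on {0..K} y"
  shows "H K x + mesh_inner K (g K x) (\<lambda>k. y k - x k) + Lambda \<alpha> lam / 2 * mesh_inner K (\<lambda>k. y k - x k) (\<lambda>k. y k - x k)
     \<le> H K y"
proof -
  have "0 \<le> Theta \<alpha> / 2 * (mesh K * (\<Sum>k=1..K. dens K x k powr (\<alpha> - 1/2) * (max 0 (1 - dens K x k / dens K y k))\<^sup>2))"
    using Theta_pos[of \<alpha>] \<alpha>1 mesh_pos[of K] assms by (intro mult_nonneg_nonneg sum_nonneg) auto
  then show ?thesis using entropy_strong_convexity[OF assms] by linarith
qed

text \<open>The square of the gradient contains the information sum, a second moment and a mixed term; summation by
parts turns the mixed term into the entropy sum, since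
density times cell width is the mesh size. The second moments match because \<open>(2\<alpha> + 1) \<Lambda>\<^sup>2 = lam\<close>. For
\<open>\<alpha> = 1/2\<close> the factor \<open>2\<alpha> - 1\<close> vanishes and the mixed term is a constant instead.\<close>

lemma information_eq:
  assumes K: "1 \<le> K" and x: "strict_mono_on {0..K} x"
  shows "F K x = mesh_inner K (g K x) (g K x) + (2 * \<alpha> - 1) * Lambda \<alpha> lam * H K x
     + (if \<alpha> = 1/2 then 2 * Theta \<alpha> * Lambda \<alpha> lam else 0)"
proof -
  let ?w = "\<lambda>k. dens K x k powr (\<alpha> + 1/2)"
  let ?D = "\<lambda>k. (?w (k + 1) - ?w k) / mesh K"
  let ?\<Theta> = "Theta \<alpha>" and ?\<Lambda> = "Lambda \<alpha> lam"
  have d: "mesh K > 0" using K by (rule mesh_pos)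
  have "mesh_inner K (g K x) (g K x) = ?\<Theta>\<^sup>2 * mesh K * (\<Sum>k=0..K. (?D k)\<^sup>2)
     + 2 * ?\<Theta> * ?\<Lambda> * (mesh K * (\<Sum>k=0..K. ?D k * x k)) + ?\<Lambda>\<^sup>2 * mesh_inner K x x"
    by (simp add: mesh_inner_def entropy_grad_def algebra_simps sum.distrib sum_distrib_left power2_eq_square)
  also have "mesh K * (\<Sum>k=0..K. ?D k * x k) = (\<Sum>k=0..K. (?w (k + 1) - ?w k) * x k)"
    using d by (simp add: sum_distrib_left)
  also have "\<dots> = - (\<Sum>k=1..K. ?w k * (x k - x (k - 1)))"
    by (subst summation_by_parts) auto
  also have "(\<Sum>k=1..K. ?w k * (x k - x (k - 1))) = (\<Sum>k=1..K. mesh K * dens K x k powr (\<alpha> - 1/2))"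
  proof (intro sum.cong refl)
    fix k assume k: "k \<in> {1..K}"
    have "dens K x k powr (\<alpha> + 1/2) = dens K x k powr (\<alpha> - 1/2) * dens K x k"
      by (rule powr_plus_half[OF dens_pos[OF x k]])
    then show "?w k * (x k - x (k - 1)) = mesh K * dens K x k powr (\<alpha> - 1/2)"
      using dens_times_step[OF x k] by simp
  qed
  finally have g: "mesh_inner K (g K x) (g K x) = ?\<Theta>\<^sup>2 * mesh K * (\<Sum>k=0..K. (?D k)\<^sup>2)
     - 2 * ?\<Theta> * ?\<Lambda> * (\<Sum>k=1..K. mesh K * dens K x k powr (\<alpha> - 1/2)) + ?\<Lambda>\<^sup>2 * mesh_inner K x x"
    by simp
  have e: "2 * ?\<Theta> * ?\<Lambda> * (\<Sum>k=1..K. mesh K * dens K x k powr (\<alpha> - 1/2))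
      = (2 * \<alpha> - 1) * ?\<Lambda> * (mesh K * (\<Sum>k=1..K. entropy_fun \<alpha> (dens K x k)))
      + (if \<alpha> = 1/2 then 2 * ?\<Theta> * ?\<Lambda> else 0)"
  proof (cases "\<alpha> = 1/2")
    case True
    have "(\<Sum>k=1..K. mesh K * dens K x k powr (\<alpha> - 1/2)) = (\<Sum>k=1..K. mesh K)"
      using True dens_pos[OF x] by (intro sum.cong refl) (metis cancel_comm_monoid_add_class.diff_cancel less_irrefl mult.right_neutral powr_zero_eq_one)
    then have one: "(\<Sum>k=1..K. mesh K * dens K x k powr (\<alpha> - 1/2)) = 1"
      using mesh_times[OF K] by (simp add: mult.commute)
    show ?thesis unfolding one using True by simp
  next
    case False
    have "(2 * \<alpha> - 1) * entropy_fun \<alpha> s = 2 * ?\<Theta> * s powr (\<alpha> - 1/2)" for s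
      using False by (simp add: entropy_fun_def field_simps)
    then have "(2 * \<alpha> - 1) * (\<Sum>k=1..K. entropy_fun \<alpha> (dens K x k)) = 2 * ?\<Theta> * (\<Sum>k=1..K. dens K x k powr (\<alpha> - 1/2))"
      by (simp add: sum_distrib_left)
    then have "?\<Lambda> * mesh K * ((2 * \<alpha> - 1) * (\<Sum>k=1..K. entropy_fun \<alpha> (dens K x k)))
       = ?\<Lambda> * mesh K * (2 * ?\<Theta> * (\<Sum>k=1..K. dens K x k powr (\<alpha> - 1/2)))"
      by simp
    then show ?thesis using False by (simp add: sum_distrib_left mult_ac)
  qed
  have l: "lam / 2 = ?\<Lambda>\<^sup>2 + (2 * \<alpha> - 1) * ?\<Lambda> * (?\<Lambda> / 2)"
    using Lambda_sq[of \<alpha> lam] \<alpha>1 lam by (simp add: power2_eq_square algebra_simps)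
  have "lam / 2 * mesh_inner K x x = ?\<Lambda>\<^sup>2 * mesh_inner K x x + (2 * \<alpha> - 1) * ?\<Lambda> * (?\<Lambda> / 2 * mesh_inner K x x)"
    unfolding l by (simp add: algebra_simps)
  then show ?thesis using g e unfolding information_def entropy_def norm_mesh_square
    by (simp only: distrib_left)
qed

section \<open>The information along the entropy gradient\<close>

lemma information_nonneg: "1 \<le> K \<Longrightarrow> 0 \<le> F K x"
  unfolding information_def using mesh_pos[of K] lam
  by (intro add_nonneg_nonneg mult_nonneg_nonneg sum_nonneg) auto

text \<open>Monotonicity of the gradient gives \<open>\<langle>g(z), g(x)\<rangle> \<ge> (1 + \<Lambda>\<epsilon>) |g(x)|\<^sup>2\<close> at \<open>z = x + \<epsilon> g(x)\<close>, so the norm of the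
gradient increases by the factor \<open>1 + \<Lambda>\<epsilon>\<close>; convexity bounds the increase of the entropy. This replaces a
computation with the Hessian of the entropy.\<close>

lemma information_growth:
  assumes K: "1 \<le> K" and x: "strict_mono_on {0..K} x" and \<epsilon>: "0 < \<epsilon>"
    and z: "strict_mono_on {0..K} (\<lambda>k. x k + \<epsilon> * g K x k)"
  shows "F K x + \<epsilon> * ((2 * \<alpha> + 1) * Lambda \<alpha> lam * mesh_inner K (g K x) (g K x))
    \<le> F K (\<lambda>k. x k + \<epsilon> * g K x k)"
proof -
  let ?z = "\<lambda>k. x k + \<epsilon> * g K x k"
  let ?L = "Lambda \<alpha> lam"
  define n where "n = mesh_inner K (g K x) (g K x)"
  define m where "m = mesh_inner K (g K ?z) (g K x)"
  define N where "N = mesh_inner K (g K ?z) (g K ?z)"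
  have L: "?L > 0" using Lambda_pos[of \<alpha> lam] \<alpha>1 lam by simp
  have n: "n \<ge> 0" "N \<ge> 0" by (auto simp: n_def N_def mesh_inner_nonneg)
  have xz: "(\<lambda>k. ?z k - x k) = (\<lambda>k. \<epsilon> * g K x k)" "(\<lambda>k. x k - ?z k) = (\<lambda>k. - \<epsilon> * g K x k)"
    by auto
  have sc: "mesh_inner K v (\<lambda>k. c * w k) = c * mesh_inner K v w" "mesh_inner K (\<lambda>k. c * w k) v = c * mesh_inner K w v" for c v w
    by (simp_all add: mesh_inner_def sum_distrib_left mult_ac)
  have 1: "H K x + \<epsilon> * n + ?L / 2 * (\<epsilon> * (\<epsilon> * n)) \<le> H K ?z"
    using entropy_convex[OF K x z] unfolding xz sc n_def .
  have 2: "H K ?z + - \<epsilon> * m + ?L / 2 * (- \<epsilon> * (- \<epsilon> * n)) \<le> H K x"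
    using entropy_convex[OF K z x] unfolding xz sc n_def m_def .
  have "\<epsilon> * ((1 + ?L * \<epsilon>) * n) \<le> \<epsilon> * m"
    using 1 2 by (simp add: algebra_simps)
  then have m: "(1 + ?L * \<epsilon>) * n \<le> m" using \<epsilon> by simp
  have N: "n + 2 * ?L * \<epsilon> * n \<le> N"
  proof (cases "n = 0")
    case True
    then show ?thesis using n by simp
  next
    case False
    have "((1 + ?L * \<epsilon>) * n)\<^sup>2 \<le> m\<^sup>2"
      using m n L \<epsilon> by (intro power_mono) auto
    also have "\<dots> \<le> N * n" unfolding m_def N_def n_def by (rule mesh_inner_cauchy)
    finally have "n * ((1 + ?L * \<epsilon>)\<^sup>2 * n) \<le> n * N"
      by (simp add: power2_eq_square mult_ac)
    then have *: "(1 + ?L * \<epsilon>)\<^sup>2 * n \<le> N" using False n by simp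
    have "(1 + 2 * ?L * \<epsilon>) * n \<le> (1 + ?L * \<epsilon>)\<^sup>2 * n"
      using n L \<epsilon> by (intro mult_right_mono) (simp_all add: power2_eq_square algebra_simps)
    with * show ?thesis by (simp add: algebra_simps)
  qed
  have Hd: "\<epsilon> * n \<le> H K ?z - H K x"
  proof -
    have "0 \<le> ?L / 2 * (\<epsilon> * (\<epsilon> * n))" using L \<epsilon> n by simp
    then show ?thesis using 1 by linarith
  qed
  have "(2 * \<alpha> - 1) * ?L * (\<epsilon> * n) \<le> (2 * \<alpha> - 1) * ?L * (H K ?z - H K x)"
    using Hd L \<alpha>1 by (intro mult_left_mono) auto
  then show ?thesis
    using N unfolding information_eq[OF K x] information_eq[OF K z] n_def[symmetric] N_def[symmetric]
    by (simp add: algebra_simps)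
qed

lemma eventually_strict_mono_on_perturb:
  fixes x v :: "nat \<Rightarrow> real"
  assumes x: "strict_mono_on {0..K} x"
  shows "\<forall>\<^sub>F \<epsilon> in nhds 0. strict_mono_on {0..K} (\<lambda>k. x k + \<epsilon> * v k)"
proof -
  have "\<forall>\<^sub>F \<epsilon> in nhds 0. \<forall>k\<in>{1..K}. x (k - 1) + \<epsilon> * v (k - 1) < x k + \<epsilon> * v k"
  proof (intro eventually_ball_finite ballI)
    fix k assume k: "k \<in> {1..K}"
    have "((\<lambda>\<epsilon>. (x k + \<epsilon> * v k) - (x (k - 1) + \<epsilon> * v (k - 1))) \<longlongrightarrow> (x k + 0 * v k) - (x (k - 1) + 0 * v (k - 1))) (nhds 0)"
      by (intro tendsto_intros filterlim_ident)
    then have "\<forall>\<^sub>F \<epsilon> in nhds 0. 0 < (x k + \<epsilon> * v k) - (x (k - 1) + \<epsilon> * v (k - 1))"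
      using grid_step[OF x k] by (intro order_tendstoD(1)) auto
    then show "\<forall>\<^sub>F \<epsilon> in nhds 0. x (k - 1) + \<epsilon> * v (k - 1) < x k + \<epsilon> * v k"
      by eventually_elim simp
  qed simp
  then show ?thesis
    by eventually_elim (auto intro: strict_mono_on_if_steps)
qed

lemma information_differentiable:
  assumes K: "1 \<le> K" and x: "strict_mono_on {0..K} x"
  shows "(\<lambda>\<epsilon>. F K (\<lambda>k. x k + \<epsilon> * v k)) differentiable (at (0::real))"
proof -
  have powr: "(\<lambda>\<epsilon>. dens K (\<lambda>k. x k + \<epsilon> * v k) j powr (\<alpha> + 1/2)) differentiable (at 0)" for j
  proof (cases "j \<in> {1..K}")
    case True
    let ?d = "\<lambda>\<epsilon>. mesh K / ((x j + \<epsilon> * v j) - (x (j - 1) + \<epsilon> * v (j - 1)))"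
    have pos: "0 < ?d 0" using grid_step[OF x True] mesh_pos[OF K] by simp
    have "?d differentiable (at 0)"
      using grid_step[OF x True]
      by (intro differentiable_divide differentiable_diff differentiable_add differentiable_mult differentiable_const differentiable_ident) auto
    then obtain D where "(?d has_real_derivative D) (at 0)"
      unfolding real_differentiable_def by blast
    from DERIV_fun_powr[OF this pos, of "\<alpha> + 1/2"]
    have "(\<lambda>\<epsilon>. ?d \<epsilon> powr (\<alpha> + 1/2)) differentiable (at 0)"
      unfolding real_differentiable_def by blast
    then show ?thesis using True by (simp add: dens_eq)
  next
    case False
    then have "dens K z j = 0" for z by (auto simp: dens_def)
    then show ?thesis by simp
  qed
  show ?thesis unfolding information_def norm_mesh_square mesh_inner_def unfolding power2_eq_square using mesh_pos[OF K]
    by (intro differentiable_add differentiable_mult differentiable_sum differentiable_divide ballI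
       differentiable_diff differentiable_const differentiable_ident powr) auto
qed

text \<open>At the minimizer the derivative of the penalized information in the direction \<open>g\<close> vanishes, and the
derivative of the information itself is bounded below by \<open>information_growth\<close>. The case \<open>a = 0\<close> covers
minimizers of the information.\<close>

lemma first_variation:
  assumes K: "1 \<le> K" and x: "strict_mono_on {0..K} x"
    and min: "\<And>z. strict_mono_on {0..K} z \<Longrightarrow>
      F K x + a * mesh_inner K (\<lambda>k. x k - y k) (\<lambda>k. x k - y k) \<le> F K z + a * mesh_inner K (\<lambda>k. z k - y k) (\<lambda>k. z k - y k)"
  shows "(2 * \<alpha> + 1) * Lambda \<alpha> lam * mesh_inner K (g K x) (g K x) \<le> 2 * a * mesh_inner K (g K x) (\<lambda>k. y k - x k)"
proof -
  let ?z = "\<lambda>\<epsilon> k. x k + \<epsilon> * g K x k"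
  let ?c = "(2 * \<alpha> + 1) * Lambda \<alpha> lam * mesh_inner K (g K x) (g K x)"
  let ?b = "mesh_inner K (g K x) (\<lambda>k. x k - y k)"
  obtain D where D: "((\<lambda>\<epsilon>. F K (?z \<epsilon>)) has_real_derivative D) (at 0)"
    using information_differentiable[OF K x] unfolding real_differentiable_def by blast
  have sm: "\<forall>\<^sub>F \<epsilon> in nhds 0. strict_mono_on {0..K} (?z \<epsilon>)"
    by (rule eventually_strict_mono_on_perturb[OF x])
  have quad: "mesh_inner K (\<lambda>k. ?z \<epsilon> k - y k) (\<lambda>k. ?z \<epsilon> k - y k)
      = mesh_inner K (\<lambda>k. x k - y k) (\<lambda>k. x k - y k) + 2 * \<epsilon> * ?b + \<epsilon>\<^sup>2 * mesh_inner K (g K x) (g K x)" for \<epsilon>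
    by (simp add: mesh_inner_def algebra_simps sum.distrib sum_distrib_left sum_subtractf power2_eq_square)
  define \<phi> where "\<phi> = (\<lambda>\<epsilon>. F K (?z \<epsilon>) + a * (mesh_inner K (\<lambda>k. x k - y k) (\<lambda>k. x k - y k) + 2 * \<epsilon> * ?b + \<epsilon>\<^sup>2 * mesh_inner K (g K x) (g K x)))"
  have "(\<phi> has_real_derivative D + 2 * a * ?b) (at 0)"
    unfolding \<phi>_def by (rule derivative_eq_intros D refl | simp)+
  moreover obtain d where d: "d > 0" "\<And>\<epsilon>. \<bar>0 - \<epsilon>\<bar> < d \<Longrightarrow> \<phi> 0 \<le> \<phi> \<epsilon>"
  proof -
    from sm obtain d where d: "d > 0" "\<And>\<epsilon>. dist \<epsilon> 0 < d \<Longrightarrow> strict_mono_on {0..K} (?z \<epsilon>)"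
      unfolding eventually_nhds_metric by blast
    have "\<phi> 0 \<le> \<phi> \<epsilon>" if "\<bar>0 - \<epsilon>\<bar> < d" for \<epsilon>
      using min[OF d(2), of \<epsilon>] that unfolding quad \<phi>_def by (simp add: dist_real_def)
    then show ?thesis using that d(1) by blast
  qed
  ultimately have "D + 2 * a * ?b = 0" using DERIV_local_min by blast
  moreover have "?c \<le> D"
  proof (rule tendsto_lowerbound)
    show "((\<lambda>\<epsilon>. (F K (?z (0 + \<epsilon>)) - F K (?z 0)) / \<epsilon>) \<longlongrightarrow> D) (at_right 0)"
      by (rule tendsto_mono[OF at_le[OF subset_UNIV] D[unfolded DERIV_def]])
    have "\<forall>\<^sub>F \<epsilon> in at_right 0. strict_mono_on {0..K} (?z \<epsilon>)"
      using sm by (simp add: eventually_at_filter eventually_mono)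
    moreover have "\<forall>\<^sub>F \<epsilon> in at_right 0. (0::real) < \<epsilon>" by (rule eventually_at_right_less)
    ultimately show "\<forall>\<^sub>F \<epsilon> in at_right 0. ?c \<le> (F K (?z (0 + \<epsilon>)) - F K (?z 0)) / \<epsilon>"
    proof eventually_elim
      case (elim \<epsilon>)
      then show ?case using information_growth[OF K x elim(2) elim(1)]
        by (simp add: pos_le_divide_eq mult.commute[of _ \<epsilon>])
    qed
  qed simp
  moreover have "mesh_inner K (g K x) (\<lambda>k. y k - x k) = - ?b"
    by (simp add: mesh_inner_diff_right)
  ultimately show ?thesis by simp
qed

section \<open>Existence of proximal minimizers\<close>

lemma information_cong: "(\<And>k. k \<le> K \<Longrightarrow> x k = y k) \<Longrightarrow> F K x = F K y"
  using dens_cong[of K x y] mesh_inner_cong[of K x y x y] by (simp add: information_def norm_mesh_square)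

lemma restrict_in_grids: "strict_mono_on {0..K} x \<Longrightarrow> restrict x {0..K} \<in> grids K"
  by (auto simp: grids_def strict_mono_on_def)

text \<open>Coercivity: a bound on the functional bounds the grid points through the second moment, and bounds the densities
because the jumps of \<open>z powr (\<alpha> + 1/2)\<close> are bounded and the outermost value is zero. Hence cells cannot
collapse, and sublevel sets lie in a compact set of grids.\<close>

lemma proximal_minimizer_exists:
  assumes K: "1 \<le> K" and y: "y \<in> grids K" and a: "0 \<le> a"
  shows "\<exists>x\<in>grids K. \<forall>z\<in>grids K.
      F K x + a * mesh_inner K (\<lambda>k. x k - y k) (\<lambda>k. x k - y k) \<le> F K z + a * mesh_inner K (\<lambda>k. z k - y k) (\<lambda>k. z k - y k)"
proof -
  let ?\<Phi> = "\<lambda>x. F K x + a * mesh_inner K (\<lambda>k. x k - y k) (\<lambda>k. x k - y k)"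
  let ?p = "\<alpha> + 1/2"
  have d: "mesh K > 0" using K by (rule mesh_pos)
  have T: "Theta \<alpha> > 0" using Theta_pos[of \<alpha>] \<alpha>1 by simp
  define M where "M = ?\<Phi> y"
  \<comment> \<open>\<open>R\<close> bounds the coordinates, \<open>B\<close> the jumps of the powers of the density, and \<open>\<eta>\<close> bounds the cell widths below.\<close>
  define R where "R = sqrt (2 * M / (lam * mesh K))"
  define B where "B = sqrt (M * mesh K / (Theta \<alpha>)\<^sup>2)"
  define \<eta> where "\<eta> = mesh K / (1 + real K * B)"
  have M: "M \<ge> 0" unfolding M_def using information_nonneg[OF K] a mesh_inner_nonneg by simp
  have B: "B \<ge> 0" unfolding B_def using M d by simp
  have \<eta>: "\<eta> > 0" unfolding \<eta>_def using d B by (intro divide_pos_pos add_pos_nonneg) auto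
  \<comment> \<open>Outside the index range the vectors are fixed, so that \<open>C\<close> is a compact set of functions on all of \<open>nat\<close>.\<close>
  define C where "C = PiE UNIV (\<lambda>k. if k \<le> K then {-R..R} else {undefined :: real})
      \<inter> (\<Inter>k\<in>{1..K}. {x. \<eta> \<le> x k - x (k - 1)})"
  have sublevel: "x \<in> C" if x: "x \<in> grids K" and le: "?\<Phi> x \<le> M" for x
  proof -
    have sm: "strict_mono_on {0..K} x" using x by (simp add: grids_def)
    have "0 \<le> a * mesh_inner K (\<lambda>k. x k - y k) (\<lambda>k. x k - y k)" using a mesh_inner_nonneg by simp
    then have FM: "F K x \<le> M" using le by simp
    let ?w = "\<lambda>k. dens K x k powr ?p"
    have nn: "0 \<le> (Theta \<alpha>)\<^sup>2 * mesh K * (\<Sum>k=0..K. ((?w (k + 1) - ?w k) / mesh K)\<^sup>2)"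
      using d by (intro mult_nonneg_nonneg sum_nonneg) auto
    have x_bd: "\<bar>x k\<bar> \<le> R" if k: "k \<le> K" for k
    proof -
      have "(x k)\<^sup>2 \<le> (\<Sum>k=0..K. (x k)\<^sup>2)" using k by (intro member_le_sum) auto
      then have "lam / 2 * (mesh K * (x k)\<^sup>2) \<le> lam / 2 * mesh_inner K x x"
        using d lam by (simp add: mesh_inner_def power2_eq_square)
      also have "\<dots> \<le> M" using FM nn unfolding information_def norm_mesh_square by linarith
      finally have "(x k)\<^sup>2 \<le> 2 * M / (lam * mesh K)"
        using d lam by (simp add: field_simps)
      then show ?thesis unfolding R_def using real_sqrt_le_mono by fastforce
    qed
    have step_bd: "\<bar>?w (k + 1) - ?w k\<bar> \<le> B" if k: "k \<le> K" for k
    proof -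
      have "((?w (k + 1) - ?w k) / mesh K)\<^sup>2 \<le> (\<Sum>k=0..K. ((?w (k + 1) - ?w k) / mesh K)\<^sup>2)"
        using k by (intro member_le_sum) auto
      then have "(Theta \<alpha>)\<^sup>2 * mesh K * ((?w (k + 1) - ?w k) / mesh K)\<^sup>2
          \<le> (Theta \<alpha>)\<^sup>2 * mesh K * (\<Sum>k=0..K. ((?w (k + 1) - ?w k) / mesh K)\<^sup>2)"
        using d by (intro mult_left_mono) auto
      also have "\<dots> \<le> M"
      proof -
        have "0 \<le> lam / 2 * mesh_inner K x x" using lam mesh_inner_nonneg by simp
        then show ?thesis using FM unfolding information_def norm_mesh_square by linarith
      qed
      also have "(Theta \<alpha>)\<^sup>2 * mesh K * ((?w (k + 1) - ?w k) / mesh K)\<^sup>2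
          = (Theta \<alpha>)\<^sup>2 * (?w (k + 1) - ?w k)\<^sup>2 / mesh K"
        using d by (simp add: power_divide power2_eq_square)
      finally have "(?w (k + 1) - ?w k)\<^sup>2 \<le> M * mesh K / (Theta \<alpha>)\<^sup>2"
        using d T by (simp add: pos_divide_le_eq pos_le_divide_eq mult.commute)
      then show ?thesis unfolding B_def using real_sqrt_le_mono by fastforce
    qed
    have w_bd: "?w k \<le> real k * B" if "k \<le> K" for k
      using that
    proof (induction k)
      case (Suc k)
      then show ?case using step_bd[of k] by (simp add: algebra_simps)
    qed simp
    have step: "\<eta> \<le> x k - x (k - 1)" if k: "k \<in> {1..K}" for k
    proof -
      have pos: "0 < dens K x k" using sm k by (rule dens_pos)
      have "dens K x k \<le> 1 + real K * B"
      proof (cases "dens K x k \<le> 1")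
        case True
        then show ?thesis using B by (smt (verit) mult_nonneg_nonneg of_nat_0_le_iff)
      next
        case False
        then have "dens K x k powr 1 \<le> ?w k" using \<alpha>1 by (intro powr_mono) auto
        also have "\<dots> \<le> real k * B" using w_bd k by simp
        also have "\<dots> \<le> real K * B" using k B by (intro mult_right_mono) auto
        finally show ?thesis using pos by simp
      qed
      then have "mesh K / (1 + real K * B) \<le> mesh K / dens K x k"
        using pos d by (intro divide_left_mono) auto
      then show ?thesis using d k by (simp add: \<eta>_def dens_eq)
    qed
    have "x k \<in> {-R..R}" if "k \<le> K" for k
      using x_bd[OF that] by (auto simp: abs_le_iff)
    then show ?thesis using x step by (auto simp: C_def grids_def PiE_iff extensional_def)
  qed
  have C_grids: "C \<subseteq> grids K"
  proof
    fix x assume x: "x \<in> C"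
    have "strict_mono_on {0..K} x"
    proof (rule strict_mono_on_if_steps)
      fix k assume k: "k \<in> {1..K}"
      have "\<eta> \<le> x k - x (k - 1)" using x k unfolding C_def by blast
      then show "x (k - 1) < x k" using \<eta> by linarith
    qed
    moreover have "x \<in> {0..K} \<rightarrow>\<^sub>E UNIV"
      using x by (auto simp: C_def PiE_iff extensional_def split: if_splits)
    ultimately show "x \<in> grids K" by (simp add: grids_def)
  qed
  have coord: "continuous_on A (\<lambda>x::nat \<Rightarrow> real. x k)" for A k
    by (rule continuous_on_subset[OF continuous_on_product_coordinates[of k] subset_UNIV])
  have "compact C"
    unfolding C_def
  proof (rule compact_Int_closed)
    have "compactin (product_topology (\<lambda>_::nat. euclidean :: real topology) UNIV)
        (PiE UNIV (\<lambda>k. if k \<le> K then {-R..R} else {undefined}))"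
      by (subst compactin_PiE) auto
    then show "compact (PiE UNIV (\<lambda>k. if k \<le> K then {-R..R} else {undefined :: real}))"
      by (simp add: euclidean_product_topology)
    show "closed (\<Inter>k\<in>{1..K}. {x :: nat \<Rightarrow> real. \<eta> \<le> x k - x (k - 1)})"
      by (intro closed_INT ballI closed_Collect_le continuous_on_diff continuous_on_const coord)
  qed
  moreover have "continuous_on C ?\<Phi>"
  proof -
    have dens_cont: "continuous_on C (\<lambda>x. dens K x k powr ?p)" for k
    proof (cases "k \<in> {1..K}")
      case True
      have pos: "0 < x k - x (k - 1)" if "x \<in> C" for x
        using that C_grids True grid_step[of K x k] by (auto simp: grids_def)
      then have pos_ne: "x k - x (k - 1) \<noteq> 0" "mesh K / (x k - x (k - 1)) \<noteq> 0" if "x \<in> C" for x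
        using that d by (metis less_irrefl, metis divide_pos_pos less_irrefl)
      have "continuous_on C (\<lambda>x. (mesh K / (x k - x (k - 1))) powr ?p)"
        using pos_ne by (intro continuous_on_powr continuous_on_divide continuous_on_diff continuous_on_const coord) auto
      then show ?thesis using True by (simp add: dens_eq)
    next
      case False
      then have "dens K x k = 0" for x by (auto simp: dens_def)
      then show ?thesis by simp
    qed
    show ?thesis unfolding information_def norm_mesh_square mesh_inner_def
      using d by (intro continuous_on_add continuous_on_mult continuous_on_sum continuous_on_power
          continuous_on_divide continuous_on_diff continuous_on_const coord dens_cont ballI) auto
  qed
  moreover have "y \<in> C" using y by (rule sublevel) (simp add: M_def)
  ultimately obtain x where x: "x \<in> C" "\<And>z. z \<in> C \<Longrightarrow> ?\<Phi> x \<le> ?\<Phi> z"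
    using continuous_attains_inf[of C ?\<Phi>] by blast
  have "?\<Phi> x \<le> ?\<Phi> z" if "z \<in> grids K" for z
    using x(2)[OF sublevel[OF that]] x(2)[OF \<open>y \<in> C\<close>] unfolding M_def by linarith
  then show ?thesis using x(1) C_grids by blast
qed

section \<open>The common minimizer of entropy and information\<close>

text \<open>A minimizer of the information is a critical point of the entropy.\<close>

lemma critical_point_exists:
  assumes K: "1 \<le> K"
  shows "\<exists>x\<in>grids K. \<forall>k\<le>K. g K x k = 0"
proof -
  have "restrict real {0..K} \<in> grids K"
    by (rule restrict_in_grids) (simp add: strict_mono_on_def)
  from proximal_minimizer_exists[OF K this, of 0] obtain x where
    x: "x \<in> grids K" "\<And>z. z \<in> grids K \<Longrightarrow> F K x \<le> F K z"
    by auto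
  have sm: "strict_mono_on {0..K} x" using x by (simp add: grids_def)
  have min: "F K x \<le> F K z" if "strict_mono_on {0..K} z" for z
    using x(2)[OF restrict_in_grids[OF that]] information_cong[of K "restrict z {0..K}" z] by simp
  have "(2 * \<alpha> + 1) * Lambda \<alpha> lam * mesh_inner K (g K x) (g K x) \<le> 0"
    using first_variation[OF K sm, of 0 x] min by simp
  moreover have "0 < (2 * \<alpha> + 1) * Lambda \<alpha> lam"
    using Lambda_pos[of \<alpha> lam] \<alpha>1 lam by simp
  ultimately have "mesh_inner K (g K x) (g K x) \<le> 0"
    by (meson mult_pos_pos not_le)
  then show ?thesis using mesh_inner_zero[OF K] x(1) by blast
qed

lemma entropy_critical_gap:
  assumes K: "1 \<le> K" and x: "x \<in> grids K" "\<forall>k\<le>K. g K x k = 0" and y: "y \<in> grids K"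
  shows "H K x + Lambda \<alpha> lam / 2 * mesh_inner K (\<lambda>k. y k - x k) (\<lambda>k. y k - x k) \<le> H K y"
proof -
  have "mesh_inner K (g K x) (\<lambda>k. y k - x k) = 0" using x(2) by (simp add: mesh_inner_def)
  then show ?thesis using entropy_convex[OF K, of x y] x y by (simp add: grids_def)
qed

text \<open>Strong convexity at a critical point leaves no other minimizer, so the definite description \<open>x_min\<close> denotes it.\<close>

lemma x_min_critical:
  assumes K: "1 \<le> K"
  shows "x_min \<alpha> lam K \<in> grids K" and "\<forall>k\<le>K. g K (x_min \<alpha> lam K) k = 0"
proof -
  obtain x where x: "x \<in> grids K" "\<forall>k\<le>K. g K x k = 0"
    using critical_point_exists[OF K] by blast
  have L: "Lambda \<alpha> lam > 0" using Lambda_pos[of \<alpha> lam] \<alpha>1 lam by simp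
  note gap = entropy_critical_gap[OF K x]
  have "x_min \<alpha> lam K = x"
    unfolding x_min_def is_minimizer_def is_arg_min_linorder
  proof (rule the_equality)
    have "H K x \<le> H K y" if "y \<in> grids K" for y
    proof -
      have "0 \<le> Lambda \<alpha> lam / 2 * mesh_inner K (\<lambda>k. y k - x k) (\<lambda>k. y k - x k)"
        using L mesh_inner_nonneg by simp
      then show ?thesis using gap[OF that] by linarith
    qed
    then show "x \<in> grids K \<and> (\<forall>y. y \<in> grids K \<longrightarrow> H K x \<le> H K y)"
      using x(1) by blast
  next
    fix y assume y: "y \<in> grids K \<and> (\<forall>z. z \<in> grids K \<longrightarrow> H K y \<le> H K z)"
    then have "Lambda \<alpha> lam / 2 * mesh_inner K (\<lambda>k. y k - x k) (\<lambda>k. y k - x k) \<le> 0"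
      using gap[of y] x(1) by (smt (verit))
    then have "mesh_inner K (\<lambda>k. y k - x k) (\<lambda>k. y k - x k) \<le> 0" using L by (simp add: mult_le_0_iff)
    then have "y k = x k" if "k \<le> K" for k using mesh_inner_zero[OF K] that by fastforce
    then show "y = x" using x(1) y by (auto simp: grids_def intro!: PiE_ext[of y "{0..K}" _ x])
  qed
  then show "x_min \<alpha> lam K \<in> grids K" and "\<forall>k\<le>K. g K (x_min \<alpha> lam K) k = 0"
    using x by auto
qed

lemma entropy_min_le:
  assumes K: "1 \<le> K" and x: "x \<in> grids K"
  shows "H K (x_min \<alpha> lam K) \<le> H K x"
proof -
  have "0 \<le> Lambda \<alpha> lam / 2 * mesh_inner K (\<lambda>k. x k - x_min \<alpha> lam K k) (\<lambda>k. x k - x_min \<alpha> lam K k)"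
    using Lambda_pos[of \<alpha> lam] \<alpha>1 lam mesh_inner_nonneg by simp
  then show ?thesis using entropy_critical_gap[OF K x_min_critical[OF K] x] by linarith
qed

text \<open>Minimize the quadratic lower bound of the entropy given by strong convexity.\<close>

lemma entropy_gap_le_slope:
  assumes K: "1 \<le> K" and x: "x \<in> grids K"
  shows "2 * Lambda \<alpha> lam * (H K x - H K (x_min \<alpha> lam K)) \<le> mesh_inner K (g K x) (g K x)"
proof -
  let ?L = "Lambda \<alpha> lam"
  let ?v = "\<lambda>k. x_min \<alpha> lam K k - x k"
  have L: "?L > 0" using Lambda_pos[of \<alpha> lam] \<alpha>1 lam by simp
  have "H K x + mesh_inner K (g K x) ?v + ?L / 2 * mesh_inner K ?v ?v \<le> H K (x_min \<alpha> lam K)"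
    using x x_min_critical(1)[OF K] by (intro entropy_convex K) (auto simp: grids_def)
  then have "2 * ?L * (H K x - H K (x_min \<alpha> lam K)) \<le> 2 * ?L * (- mesh_inner K (g K x) ?v - ?L / 2 * mesh_inner K ?v ?v)"
    using L by (intro mult_left_mono) auto
  also have "\<dots> = mesh_inner K (g K x) (g K x) - mesh_inner K (\<lambda>k. g K x k + ?L * ?v k) (\<lambda>k. g K x k + ?L * ?v k)"
    by (simp only: mesh_inner_square_add) (simp add: power2_eq_square algebra_simps)
  also have "\<dots> \<le> mesh_inner K (g K x) (g K x)" using mesh_inner_nonneg by simp
  finally show ?thesis .
qed

lemma information_gap:
  assumes K: "1 \<le> K" and x: "x \<in> grids K"
  shows "F K x - F K (x_min \<alpha> lam K)
     = mesh_inner K (g K x) (g K x) + (2 * \<alpha> - 1) * Lambda \<alpha> lam * (H K x - H K (x_min \<alpha> lam K))"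
proof -
  have "mesh_inner K (g K (x_min \<alpha> lam K)) (g K (x_min \<alpha> lam K)) = 0"
    using x_min_critical(2)[OF K] by (simp add: mesh_inner_def)
  moreover have "strict_mono_on {0..K} x" "strict_mono_on {0..K} (x_min \<alpha> lam K)"
    using x x_min_critical(1)[OF K] by (auto simp: grids_def)
  note this[THEN information_eq[OF K]]
  ultimately show ?thesis unfolding right_diff_distrib by linarith
qed

text \<open>The minimizer of the entropy makes both the gradient term and the entropy term of the information minimal.\<close>

lemma information_min_le:
  assumes K: "1 \<le> K" and x: "x \<in> grids K"
  shows "F K (x_min \<alpha> lam K) \<le> F K x"
proof -
  have "0 \<le> (2 * \<alpha> - 1) * Lambda \<alpha> lam * (H K x - H K (x_min \<alpha> lam K))"
    using entropy_min_le[OF assms] Lambda_pos[of \<alpha> lam] \<alpha>1 lam by simp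
  then show ?thesis using information_gap[OF assms] mesh_inner_nonneg[of K "g K x"] by linarith
qed

lemma information_gap_le_slope:
  assumes K: "1 \<le> K" and x: "x \<in> grids K"
  shows "F K x - F K (x_min \<alpha> lam K) \<le> (2 * \<alpha> + 1) / 2 * mesh_inner K (g K x) (g K x)"
proof -
  have "(2 * \<alpha> - 1) / 2 * (2 * Lambda \<alpha> lam * (H K x - H K (x_min \<alpha> lam K)))
     \<le> (2 * \<alpha> - 1) / 2 * mesh_inner K (g K x) (g K x)"
    using entropy_gap_le_slope[OF assms] \<alpha>1 by (intro mult_left_mono) auto
  then have "(2 * \<alpha> - 1) * Lambda \<alpha> lam * (H K x - H K (x_min \<alpha> lam K)) \<le> (2 * \<alpha> - 1) / 2 * mesh_inner K (g K x) (g K x)"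
    by simp
  moreover have "(2 * \<alpha> + 1) / 2 * mesh_inner K (g K x) (g K x) = mesh_inner K (g K x) (g K x) + (2 * \<alpha> - 1) / 2 * mesh_inner K (g K x) (g K x)"
    by (simp add: field_simps)
  ultimately show ?thesis using information_gap[OF assms] by linarith
qed

end

section \<open>Decay in one proximal step\<close>

text \<open>Let \<open>\<phi>(\<sigma>)\<close> be the minimal value of \<open>F + D / (2\<sigma>)\<close>, attained at \<open>\<xi>(\<sigma>)\<close>. Formally
\<open>\<phi>' = - D(\<xi>(\<sigma>)) / (2\<sigma>\<^sup>2) \<le> - c (F(\<xi>(\<sigma>)) - m)\<close>, and \<open>F(\<xi>(\<sigma>))\<close> decreases in \<open>\<sigma>\<close>, so \<open>\<phi>\<close> drops by at least
\<open>c \<tau> (F(x) - m)\<close> between \<open>0\<close> and \<open>\<tau>\<close>; the term \<open>D(x) / (2\<tau>)\<close> in \<open>\<phi>(\<tau>)\<close> contributes the same amount once more.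
Summing differences of \<open>\<phi>\<close> along a geometric sequence avoids differentiating \<open>\<phi>\<close>.\<close>

lemma de_giorgi_interpolation:
  fixes F D :: "'a \<Rightarrow> real" and S :: "'a set"
  defines "prox \<equiv> \<lambda>\<sigma> x. \<forall>z\<in>S. F x + D x / (2 * \<sigma>) \<le> F z + D z / (2 * \<sigma>)"
  assumes \<tau>: "0 < \<tau>" and c: "0 \<le> c" and y: "y \<in> S" "D y = 0"
    and x: "x \<in> S" "prox \<tau> x" "m \<le> F x"
    and ex: "\<And>\<sigma>. 0 < \<sigma> \<Longrightarrow> \<exists>x\<in>S. prox \<sigma> x"
    and slope: "\<And>\<sigma> x. 0 < \<sigma> \<Longrightarrow> x \<in> S \<Longrightarrow> prox \<sigma> x \<Longrightarrow> 2 * c * \<sigma>\<^sup>2 * (F x - m) \<le> D x"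
  shows "(1 + 2 * c * \<tau>) * (F x - m) \<le> F y - m"
proof -
  define E where "E = F x - m"
  have E: "E \<ge> 0" using x by (simp add: E_def)
  obtain \<xi> where \<xi>: "\<And>\<sigma>. 0 < \<sigma> \<Longrightarrow> \<xi> \<sigma> \<in> S" "\<And>\<sigma>. 0 < \<sigma> \<Longrightarrow> prox \<sigma> (\<xi> \<sigma>)"
    using ex by metis
  define \<phi> where "\<phi> = (\<lambda>\<sigma>. F (\<xi> \<sigma>) + D (\<xi> \<sigma>) / (2 * \<sigma>))"
  have \<phi>_le: "\<phi> \<sigma> \<le> F z + D z / (2 * \<sigma>)" if "0 < \<sigma>" "z \<in> S" for \<sigma> z
    using \<xi>(2)[OF that(1)] that(2) by (simp add: \<phi>_def prox_def)
  have \<phi>_\<tau>: "F x + D x / (2 * \<tau>) \<le> \<phi> \<tau>"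
    using x \<xi>(1)[OF \<tau>] by (simp add: \<phi>_def prox_def)
  have D_\<xi>: "2 * c * \<sigma>\<^sup>2 * E \<le> D (\<xi> \<sigma>)" if \<sigma>: "0 < \<sigma>" "\<sigma> < \<tau>" for \<sigma>
  proof -
    have 1: "F (\<xi> \<sigma>) + D (\<xi> \<sigma>) / (2 * \<sigma>) \<le> F x + D x / (2 * \<sigma>)"
      using \<phi>_le[OF \<sigma>(1) x(1)] by (simp add: \<phi>_def)
    have 2: "F x + D x / (2 * \<tau>) \<le> F (\<xi> \<sigma>) + D (\<xi> \<sigma>) / (2 * \<tau>)"
      using x \<xi>(1)[OF \<sigma>(1)] by (simp add: prox_def)
    have "(D (\<xi> \<sigma>) - D x) * (1 / (2 * \<sigma>) - 1 / (2 * \<tau>))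
        = D (\<xi> \<sigma>) / (2 * \<sigma>) - D x / (2 * \<sigma>) - (D (\<xi> \<sigma>) / (2 * \<tau>) - D x / (2 * \<tau>))"
      by (simp add: left_diff_distrib right_diff_distrib diff_divide_distrib)
    then have "(D (\<xi> \<sigma>) - D x) * (1 / (2 * \<sigma>) - 1 / (2 * \<tau>)) \<le> 0"
      using 1 2 by linarith
    moreover have "0 < 1 / (2 * \<sigma>) - 1 / (2 * \<tau>)"
      using \<sigma> by (simp add: frac_less2)
    ultimately have "D (\<xi> \<sigma>) \<le> D x" by (simp add: mult_le_0_iff)
    then have "D (\<xi> \<sigma>) / (2 * \<tau>) \<le> D x / (2 * \<tau>)" using \<tau> by (simp add: divide_right_mono)
    then have "E \<le> F (\<xi> \<sigma>) - m" using 2 by (simp add: E_def)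
    then have "2 * c * \<sigma>\<^sup>2 * E \<le> 2 * c * \<sigma>\<^sup>2 * (F (\<xi> \<sigma>) - m)" using c by (intro mult_left_mono) auto
    then show ?thesis using slope[OF \<sigma>(1) \<xi>(1)[OF \<sigma>(1)] \<xi>(2)[OF \<sigma>(1)]] by linarith
  qed
  have step: "\<phi> \<sigma> + c * E * (r * (\<sigma> - r * \<sigma>)) \<le> \<phi> (r * \<sigma>)"
    if r: "0 < r" "r < 1" and \<sigma>: "0 < \<sigma>" "\<sigma> \<le> \<tau>" for r \<sigma>
  proof -
    let ?s = "r * \<sigma>"
    have s: "0 < ?s" "?s < \<sigma>" using r \<sigma> by auto
    have "\<phi> \<sigma> \<le> F (\<xi> ?s) + D (\<xi> ?s) / (2 * \<sigma>)" using \<phi>_le[OF \<sigma>(1) \<xi>(1)[OF s(1)]] .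
    also have "\<dots> = \<phi> ?s - D (\<xi> ?s) * ((\<sigma> - ?s) / (2 * ?s * \<sigma>))"
      using r \<sigma> by (simp add: \<phi>_def field_simps)
    also have "\<dots> \<le> \<phi> ?s - (2 * c * ?s\<^sup>2 * E) * ((\<sigma> - ?s) / (2 * ?s * \<sigma>))"
      using D_\<xi>[of ?s] s \<sigma> by (intro diff_left_mono mult_right_mono) auto
    also have "(2 * c * ?s\<^sup>2 * E) * ((\<sigma> - ?s) / (2 * ?s * \<sigma>)) = c * E * (r * (\<sigma> - r * \<sigma>))"
      using r \<sigma> by (simp add: field_simps power2_eq_square)
    finally show ?thesis by simp
  qed
  \<comment> \<open>Telescoping along \<open>\<sigma> = \<tau> r\<^sup>N\<close>.\<close>
  have part: "\<phi> \<tau> + c * E * r * \<tau> * (1 - r ^ N) \<le> \<phi> (\<tau> * r ^ N)" if r: "0 < r" "r < 1" for r N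
  proof (induction N)
    case (Suc N)
    have "\<tau> * r ^ N \<le> \<tau>" using r \<tau> power_le_one[of r N] by simp
    then show ?case using Suc step[OF r, of "\<tau> * r ^ N"] r \<tau> by (simp add: algebra_simps)
  qed simp
  have lim: "r * (c * E * \<tau>) \<le> F y - \<phi> \<tau>" if r: "0 < r" "r < 1" for r
  proof -
    have "\<phi> \<tau> + c * E * r * \<tau> * (1 - r ^ N) \<le> F y" for N
      using part[OF r, of N] \<phi>_le[of "\<tau> * r ^ N" y] y r \<tau> by simp
    moreover have "(\<lambda>N. \<phi> \<tau> + c * E * r * \<tau> * (1 - r ^ N)) \<longlonglongrightarrow> \<phi> \<tau> + c * E * r * \<tau> * (1 - 0)"
      using r by (intro tendsto_intros LIMSEQ_power_zero) auto
    ultimately have "\<phi> \<tau> + c * E * r * \<tau> * (1 - 0) \<le> F y"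
      by (intro LIMSEQ_le_const2) auto
    then show ?thesis by (simp add: algebra_simps)
  qed
  \<comment> \<open>The factor \<open>r\<close> is the loss of the discretization; it disappears as \<open>r\<close> tends to \<open>1\<close>.\<close>
  have "c * E * \<tau> \<le> F y - \<phi> \<tau>"
    using lim by (rule field_le_mult_one_interval)
  moreover have "c * E * \<tau> \<le> D x / (2 * \<tau>)"
  proof -
    have "2 * c * \<tau>\<^sup>2 * E / (2 * \<tau>) \<le> D x / (2 * \<tau>)"
      using slope[OF \<tau> x(1,2)] \<tau> unfolding E_def by (intro divide_right_mono) auto
    then show ?thesis using \<tau> by (simp add: power2_eq_square mult_ac)
  qed
  ultimately show ?thesis using \<phi>_\<tau> by (simp add: E_def algebra_simps)
qed

context admissible_parameters
begin

text \<open>The first variation for one step of size \<open>\<tau>\<close>, with the comparison restricted to vectors in \<open>grids K\<close>; any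
strictly increasing vector may be restricted to the index range without changing the functional.\<close>

lemma proximal_descent:
  assumes K: "1 \<le> K" and \<tau>: "0 < \<tau>" and x: "x \<in> grids K"
    and min: "\<forall>z\<in>grids K. F K x + mesh_inner K (\<lambda>k. x k - y k) (\<lambda>k. x k - y k) / (2 * \<tau>)
        \<le> F K z + mesh_inner K (\<lambda>k. z k - y k) (\<lambda>k. z k - y k) / (2 * \<tau>)"
  shows "\<tau> * ((2 * \<alpha> + 1) * Lambda \<alpha> lam * mesh_inner K (g K x) (g K x)) \<le> mesh_inner K (g K x) (\<lambda>k. y k - x k)"
proof -
  have sm: "strict_mono_on {0..K} x" using x by (simp add: grids_def)
  have "F K x + 1 / (2 * \<tau>) * mesh_inner K (\<lambda>k. x k - y k) (\<lambda>k. x k - y k)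
      \<le> F K z + 1 / (2 * \<tau>) * mesh_inner K (\<lambda>k. z k - y k) (\<lambda>k. z k - y k)" if z: "strict_mono_on {0..K} z" for z
  proof -
    let ?r = "restrict z {0..K}"
    have "mesh_inner K (\<lambda>k. ?r k - y k) (\<lambda>k. ?r k - y k) = mesh_inner K (\<lambda>k. z k - y k) (\<lambda>k. z k - y k)"
      by (rule mesh_inner_cong) auto
    moreover have "F K ?r = F K z" by (rule information_cong) simp
    ultimately show ?thesis using min[rule_format, OF restrict_in_grids[OF z]] by simp
  qed
  from first_variation[OF K sm this]
  show ?thesis using \<tau> by (simp add: pos_le_divide_eq mult.commute)
qed

lemma entropy_step:
  assumes K: "1 \<le> K" and \<tau>: "0 < \<tau>" and x: "x \<in> grids K" and y: "y \<in> grids K"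
    and min: "\<forall>z\<in>grids K. F K x + mesh_inner K (\<lambda>k. x k - y k) (\<lambda>k. x k - y k) / (2 * \<tau>)
        \<le> F K z + mesh_inner K (\<lambda>k. z k - y k) (\<lambda>k. z k - y k) / (2 * \<tau>)"
  shows "(1 + 2 * lam * \<tau>) * (H K x - H K (x_min \<alpha> lam K)) \<le> H K y - H K (x_min \<alpha> lam K)"
proof -
  let ?L = "Lambda \<alpha> lam"
  define h where "h = H K x - H K (x_min \<alpha> lam K)"
  have L: "?L > 0" using Lambda_pos[of \<alpha> lam] \<alpha>1 lam by simp
  have l: "(2 * \<alpha> + 1) * ?L\<^sup>2 = lam" using Lambda_sq[of \<alpha> lam] \<alpha>1 lam by simp
  have "\<tau> * ((2 * \<alpha> + 1) * ?L * (2 * ?L * h)) = 2 * \<tau> * h * ((2 * \<alpha> + 1) * ?L\<^sup>2)"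
    by (simp add: power2_eq_square)
  then have "2 * lam * \<tau> * h = \<tau> * ((2 * \<alpha> + 1) * ?L * (2 * ?L * h))"
    unfolding l by (simp only: mult_ac)
  also have "\<dots> \<le> \<tau> * ((2 * \<alpha> + 1) * ?L * mesh_inner K (g K x) (g K x))"
    using entropy_gap_le_slope[OF K x] L \<tau> \<alpha>1 unfolding h_def by (intro mult_left_mono) auto
  also have "\<dots> \<le> mesh_inner K (g K x) (\<lambda>k. y k - x k)"
    by (rule proximal_descent[OF K \<tau> x min])
  also have "\<dots> \<le> H K y - H K x"
  proof -
    have "0 \<le> ?L / 2 * mesh_inner K (\<lambda>k. y k - x k) (\<lambda>k. y k - x k)" using L mesh_inner_nonneg by simp
    then show ?thesis using entropy_convex[OF K, of x y] x y by (simp add: grids_def)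
  qed
  finally show ?thesis unfolding h_def by (simp add: algebra_simps)
qed

text \<open>The first variation and the Cauchy--Schwarz inequality bound the displacement below by the gradient, which
in turn bounds the information gap.\<close>

lemma proximal_displacement:
  assumes K: "1 \<le> K" and \<tau>: "0 < \<tau>" and x: "x \<in> grids K"
    and min: "\<forall>z\<in>grids K. F K x + mesh_inner K (\<lambda>k. x k - y k) (\<lambda>k. x k - y k) / (2 * \<tau>)
        \<le> F K z + mesh_inner K (\<lambda>k. z k - y k) (\<lambda>k. z k - y k) / (2 * \<tau>)"
  shows "2 * lam * \<tau>\<^sup>2 * (F K x - F K (x_min \<alpha> lam K)) \<le> mesh_inner K (\<lambda>k. x k - y k) (\<lambda>k. x k - y k)"
proof -
  define n where "n = mesh_inner K (g K x) (g K x)"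
  define D where "D = mesh_inner K (\<lambda>k. x k - y k) (\<lambda>k. x k - y k)"
  let ?c = "(2 * \<alpha> + 1) * Lambda \<alpha> lam"
  have c: "?c > 0" using Lambda_pos[of \<alpha> lam] \<alpha>1 lam by simp
  have l: "?c\<^sup>2 = lam * (2 * \<alpha> + 1)"
    using Lambda_sq[of \<alpha> lam] \<alpha>1 lam by (simp add: power2_eq_square mult_ac)
  have n: "n \<ge> 0" "D \<ge> 0" by (auto simp: n_def D_def mesh_inner_nonneg)
  have "2 * lam * \<tau>\<^sup>2 * (F K x - F K (x_min \<alpha> lam K)) \<le> 2 * lam * \<tau>\<^sup>2 * ((2 * \<alpha> + 1) / 2 * n)"
    using information_gap_le_slope[OF K x] lam unfolding n_def by (intro mult_left_mono) auto
  also have "\<dots> = \<tau>\<^sup>2 * ?c\<^sup>2 * n" unfolding l by simp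
  also have "\<dots> \<le> D"
  proof (cases "n = 0")
    case True
    then show ?thesis using n by simp
  next
    case False
    have "(\<tau> * (?c * n))\<^sup>2 \<le> (mesh_inner K (g K x) (\<lambda>k. y k - x k))\<^sup>2"
      using proximal_descent[OF K \<tau> x min] c n \<tau> unfolding n_def by (intro power_mono) auto
    also have "\<dots> \<le> n * mesh_inner K (\<lambda>k. y k - x k) (\<lambda>k. y k - x k)" unfolding n_def by (rule mesh_inner_cauchy)
    also have "mesh_inner K (\<lambda>k. y k - x k) (\<lambda>k. y k - x k) = D"
      by (simp add: D_def mesh_inner_def algebra_simps)
    finally have "n * (\<tau>\<^sup>2 * ?c\<^sup>2 * n) \<le> n * D"
      by (simp add: power2_eq_square mult_ac)
    then show ?thesis using False n by simp
  qed
  finally show ?thesis by (simp add: D_def)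
qed

lemma information_step:
  assumes K: "1 \<le> K" and \<tau>: "0 < \<tau>" and x: "x \<in> grids K" and y: "y \<in> grids K"
    and min: "\<forall>z\<in>grids K. F K x + mesh_inner K (\<lambda>k. x k - y k) (\<lambda>k. x k - y k) / (2 * \<tau>)
        \<le> F K z + mesh_inner K (\<lambda>k. z k - y k) (\<lambda>k. z k - y k) / (2 * \<tau>)"
  shows "(1 + 2 * lam * \<tau>) * (F K x - F K (x_min \<alpha> lam K)) \<le> F K y - F K (x_min \<alpha> lam K)"
proof (rule de_giorgi_interpolation[where S = "grids K" and F = "F K" and y = y and D = "\<lambda>x. mesh_inner K (\<lambda>k. x k - y k) (\<lambda>k. x k - y k)"])
  show "\<exists>x\<in>grids K. \<forall>z\<in>grids K. F K x + mesh_inner K (\<lambda>k. x k - y k) (\<lambda>k. x k - y k) / (2 * \<sigma>)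
        \<le> F K z + mesh_inner K (\<lambda>k. z k - y k) (\<lambda>k. z k - y k) / (2 * \<sigma>)" if "0 < \<sigma>" for \<sigma>
    using proximal_minimizer_exists[OF K y, of "1 / (2 * \<sigma>)"] that by simp
  show "F K (x_min \<alpha> lam K) \<le> F K x" by (rule information_min_le[OF K x])
  show "2 * lam * \<sigma>\<^sup>2 * (F K z - F K (x_min \<alpha> lam K)) \<le> mesh_inner K (\<lambda>k. z k - y k) (\<lambda>k. z k - y k)"
    if "0 < \<sigma>" "z \<in> grids K" "\<forall>w\<in>grids K. F K z + mesh_inner K (\<lambda>k. z k - y k) (\<lambda>k. z k - y k) / (2 * \<sigma>)
        \<le> F K w + mesh_inner K (\<lambda>k. w k - y k) (\<lambda>k. w k - y k) / (2 * \<sigma>)" for \<sigma> z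
    using proximal_displacement[OF K that] .
  show "mesh_inner K (\<lambda>k. y k - y k) (\<lambda>k. y k - y k) = 0" by (simp add: mesh_inner_def)
  show "\<forall>z\<in>grids K. F K x + mesh_inner K (\<lambda>k. x k - y k) (\<lambda>k. x k - y k) / (2 * \<tau>)
        \<le> F K z + mesh_inner K (\<lambda>k. z k - y k) (\<lambda>k. z k - y k) / (2 * \<tau>)" by (rule min)
  show "0 \<le> lam" using lam by simp
qed (rule \<tau> x y)+

end

text \<open>With \<open>a = lam \<cdot> \<tau>\<^sub>n \<le> lam \<cdot> \<tau>\<close>, the factor of one step is controlled by
\<open>ln (1 + 2a) \<ge> 2a / (1 + a) \<ge> 2a / (1 + lam \<cdot> \<tau>)\<close>.\<close>

lemma discrete_decay:
  fixes e \<tau>s :: "nat \<Rightarrow> real"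
  assumes lam: "0 < lam" and \<tau>s: "\<And>n. n \<ge> 1 \<Longrightarrow> 0 < \<tau>s n \<and> \<tau>s n \<le> \<tau>"
    and e0: "0 \<le> e 0"
    and step: "\<And>n. n \<ge> 1 \<Longrightarrow> (1 + 2 * lam * \<tau>s n) * e n \<le> e (n - 1)"
  shows "e n \<le> e 0 * exp (- (2 * lam / (1 + lam * \<tau>)) * (\<Sum>j=1..n. \<tau>s j))"
proof (induction n)
  case (Suc n)
  let ?\<rho> = "2 * lam / (1 + lam * \<tau>)"
  let ?a = "lam * \<tau>s (Suc n)"
  have t: "0 < \<tau>s (Suc n)" "\<tau>s (Suc n) \<le> \<tau>" using \<tau>s[of "Suc n"] by auto
  have a: "0 < ?a" using t lam by simp
  have "?\<rho> * \<tau>s (Suc n) \<le> 2 * ?a / (1 + ?a)"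
  proof -
    have "2 * ?a / (1 + lam * \<tau>) \<le> 2 * ?a / (1 + ?a)"
      using a t lam by (intro divide_left_mono mult_pos_pos) (auto intro: add_pos_pos)
    then show ?thesis by (simp add: mult.assoc)
  qed
  also have "\<dots> \<le> ln (1 + 2 * ?a)"
    using ln_inverse_approx_ge[of 1 "1 + 2 * ?a"] a by (simp add: field_simps)
  finally have "exp (?\<rho> * \<tau>s (Suc n)) \<le> 1 + 2 * ?a"
    using a by (metis add_pos_pos exp_le_cancel_iff exp_ln mult_pos_pos zero_less_numeral zero_less_one)
  then have ex: "1 / (1 + 2 * ?a) \<le> exp (- ?\<rho> * \<tau>s (Suc n))"
    using a by (simp add: exp_minus field_simps)
  have "e (Suc n) \<le> e n / (1 + 2 * ?a)"
    using step[of "Suc n"] a by (simp add: pos_le_divide_eq mult_ac)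
  also have "\<dots> \<le> (e 0 * exp (- ?\<rho> * (\<Sum>j=1..n. \<tau>s j))) / (1 + 2 * ?a)"
    using Suc a by (intro divide_right_mono) auto
  also have "\<dots> = e 0 * exp (- ?\<rho> * (\<Sum>j=1..n. \<tau>s j)) * (1 / (1 + 2 * ?a))"
    by simp
  also have "\<dots> \<le> e 0 * exp (- ?\<rho> * (\<Sum>j=1..n. \<tau>s j)) * exp (- ?\<rho> * \<tau>s (Suc n))"
    using ex e0 by (intro mult_left_mono) auto
  also have "\<dots> = e 0 * exp (- ?\<rho> * (\<Sum>j=1..Suc n. \<tau>s j))"
    by (simp only: mult.assoc exp_add[symmetric] distrib_left[symmetric]) simp
  finally show ?case .
qed simp

section \<open>Bounds on the critical grid\<close>

text \<open>Concavity of \<open>t \<mapsto> t powr r\<close>, in the form of convexity of the exponential function on the segment from \<open>0\<close> to \<open>ln t\<close>.\<close>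

lemma powr_le_tangent:
  fixes t r :: real
  assumes "0 \<le> t" and "0 < r" and "r \<le> 1"
  shows "t powr r \<le> 1 + r * (t - 1)"
proof (cases "t = 0")
  case True
  then show ?thesis using assms by simp
next
  case False
  then have t: "t > 0" using assms by simp
  have "exp ((1 - r) *\<^sub>R 0 + r *\<^sub>R ln t) \<le> (1 - r) * exp 0 + r * exp (ln t)"
    using assms by (intro convex_onD[OF exp_convex]) auto
  then show ?thesis using t by (simp add: powr_def algebra_simps)
qed

lemma powr_secant_ge:
  fixes a b r :: real
  assumes a: "0 \<le> a" "a \<le> b" and b: "0 < b" and r: "0 < r" "r \<le> 1"
  shows "r * b powr (r - 1) * (b - a) \<le> b powr r - a powr r"
proof -
  have "b powr r * (a / b) powr r \<le> b powr r * (1 + r * (a / b - 1))"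
    using a b r by (intro mult_left_mono powr_le_tangent) auto
  also have "b powr r * (a / b) powr r = a powr r"
    using a b by (simp add: powr_divide)
  also have "b powr r * (1 + r * (a / b - 1)) = b powr r - r * b powr (r - 1) * (b - a)"
    using b by (simp add: powr_diff field_simps)
  finally show ?thesis by simp
qed

text \<open>To the right of the point \<open>1\<close>, the balance equation bounds \<open>z k powr p\<close> below by \<open>\<kappa>\<close> times the
remaining mass \<open>s k\<close>, so the cell width is at most a multiple of \<open>\<delta> \<cdot> s k powr (- 1 / p)\<close>. Since \<open>p > 1\<close>, these
widths sum to a bound that is independent of \<open>K\<close>, as \<open>s \<mapsto> s powr (- 1 / p)\<close> is integrable at zero.\<close>

lemma right_end_bound:
  fixes x z :: "nat \<Rightarrow> real" and p \<kappa> \<delta> :: real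
  assumes p: "1 < p" and \<kappa>: "0 < \<kappa>" and \<delta>: "0 < \<delta>" "\<delta> * real K = 1"
    and x: "strict_mono_on {0..K} x" "x 0 \<le> 1"
    and last: "z (K + 1) = 0"
    and z: "\<And>k. k \<in> {1..K} \<Longrightarrow> 0 < z k"
    and step: "\<And>k. k \<in> {1..K} \<Longrightarrow> z k * (x k - x (k - 1)) = \<delta>"
    and balance: "\<And>k. k \<in> {1..K} \<Longrightarrow> z k powr p - z (k + 1) powr p = \<kappa> * \<delta> * x k"
  shows "x K \<le> 1 + \<kappa> powr (- 1 / p) * p / (p - 1)"
proof -
  define s where "s = (\<lambda>k. \<delta> * (real K + 1 - real k))"
  define r where "r = 1 - 1 / p"
  define C where "C = \<kappa> powr (- 1 / p) / r"
  have r: "0 < r" "r < 1" using p by (auto simp: r_def field_simps)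
  have C: "0 < C" using r \<kappa> by (simp add: C_def)
  \<comment> \<open>Sum the balance equations from the right end, where all points are at least \<open>1\<close>.\<close>
  have tail: "\<kappa> * s k \<le> z k powr p" if k: "1 \<le> k" "k \<le> K + 1" "k \<le> K \<Longrightarrow> 1 \<le> x k" for k
  proof -
    have "(k' \<le> K \<longrightarrow> 1 \<le> x k') \<longrightarrow> \<kappa> * s k' \<le> z k' powr p" if "k \<le> k'" "k' \<le> K + 1" for k'
      using that(2,1)
    proof (induction k' rule: inc_induct)
      case base
      then show ?case using last by (simp add: s_def)
    next
      case (step n)
      show ?case
      proof
        assume n: "n \<le> K \<longrightarrow> 1 \<le> x n"
        then have xn: "1 \<le> x n" using step by simp
        have "1 \<le> x (Suc n)" if "Suc n \<le> K"
          using strict_mono_onD[OF x(1), of n "Suc n"] that xn by simp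
        then have "\<kappa> * s (Suc n) \<le> z (Suc n) powr p" using step by simp
        moreover have "\<kappa> * \<delta> * 1 \<le> \<kappa> * \<delta> * x n"
          using xn \<kappa> \<delta> by (intro mult_left_mono) auto
        moreover have "\<kappa> * s n = \<kappa> * s (Suc n) + \<kappa> * \<delta>"
          by (simp add: s_def algebra_simps)
        ultimately show "\<kappa> * s n \<le> z n powr p" using balance[of n] step k by simp
      qed
    qed
    from this[of k] show ?thesis using k by simp
  qed
  \<comment> \<open>Truncation at \<open>1\<close> restricts the telescoping sum to the part where \<open>tail\<close> applies.\<close>
  have incr: "max (x k) 1 - max (x (k - 1)) 1 \<le> C * (s k powr r - s (k + 1) powr r)" if k: "k \<in> {1..K}" for k
  proof -
    have s: "0 < s k" "0 \<le> s (k + 1)" "s (k + 1) \<le> s k" "s k - s (k + 1) = \<delta>"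
      using \<delta> mult_left_mono[of "real k" "real K" \<delta>] k by (auto simp: s_def algebra_simps)
    show ?thesis
    proof (cases "x k \<le> 1")
      case True
      have "x (k - 1) \<le> x k" using grid_step[OF x(1) k] by simp
      moreover have "s (k + 1) powr r \<le> s k powr r" using s r by (intro powr_mono2) auto
      then have "0 \<le> C * (s k powr r - s (k + 1) powr r)" using C by simp
      ultimately show ?thesis using True by simp
    next
      case False
      have "(\<kappa> * s k) powr (1 / p) \<le> (z k powr p) powr (1 / p)"
        using tail[of k] False k s \<kappa> p by (intro powr_mono2) auto
      also have "\<dots> = z k" using p z[OF k] by (simp add: powr_powr)
      finally have zk: "(\<kappa> * s k) powr (1 / p) \<le> z k" .
      have "x k - x (k - 1) = \<delta> / z k" using step[OF k] z[OF k] by (simp add: field_simps)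
      also have "\<dots> \<le> \<delta> / (\<kappa> * s k) powr (1 / p)"
        using zk \<delta> \<kappa> s z[OF k] by (intro divide_left_mono) auto
      also have "\<dots> = C * (r * s k powr (r - 1) * (s k - s (k + 1)))"
      proof -
        have "C * r = \<kappa> powr (- (1 / p))" "r - 1 = - (1 / p)" using r by (simp_all add: C_def r_def)
        moreover have "\<delta> / (\<kappa> * s k) powr (1 / p) = \<kappa> powr (- (1 / p)) * s k powr (- (1 / p)) * \<delta>"
          using \<kappa> s by (simp add: powr_mult powr_minus_divide)
        ultimately show ?thesis unfolding s(4) by (metis mult.assoc)
      qed
      also have "\<dots> \<le> C * (s k powr r - s (k + 1) powr r)"
        using C s r by (intro mult_left_mono powr_secant_ge) auto
      finally show ?thesis using False by simp
    qed
  qed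
  have "max (x k) 1 \<le> 1 + C * (s 1 powr r - s (k + 1) powr r)" if "k \<le> K" for k
    using that
  proof (induction k)
    case 0
    then show ?case using x by simp
  next
    case (Suc k)
    then show ?case using incr[of "Suc k"] by (simp add: algebra_simps)
  qed
  from this[of K] have "x K \<le> 1 + C"
    using \<delta> r by (simp add: s_def)
  also have "C = \<kappa> powr (- 1 / p) * p / (p - 1)" using p by (simp add: C_def r_def field_simps)
  finally show ?thesis .
qed

text \<open>Passes from jumps of a power of the density to jumps of the density, at the price of a weight that may
degenerate where the density is small.\<close>

lemma abs_diff_le_powr_diff:
  fixes a b \<beta> :: real
  assumes "0 \<le> a" "0 \<le> b" "0 \<le> \<beta>"
  shows "\<bar>a - b\<bar> * max a b powr \<beta> \<le> \<bar>a powr (\<beta> + 1) - b powr (\<beta> + 1)\<bar>"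
proof -
  have *: "(u - v) * u powr \<beta> \<le> u powr (\<beta> + 1) - v powr (\<beta> + 1)" if "0 \<le> v" "v \<le> u" for u v
  proof -
    have "v powr \<beta> * v \<le> u powr \<beta> * v"
      using that assms by (intro mult_right_mono powr_mono2) auto
    then show ?thesis using that by (simp add: powr_add algebra_simps)
  qed
  show ?thesis
    using *[of a b] *[of b a] assms by (cases "a \<le> b") (auto simp: max_def)
qed

lemma powr_minus_le:
  fixes t \<beta> :: real
  assumes "0 < t" "0 \<le> \<beta>" "\<beta> \<le> 1"
  shows "t powr (- \<beta>) \<le> 1 + 1 / t"
proof (cases "t \<le> 1")
  case True
  have "t powr (- \<beta>) \<le> t powr (- 1)" using assms True by (intro powr_mono') auto
  then show ?thesis using assms by (simp add: powr_minus_divide)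
next
  case False
  have "t powr (- \<beta>) \<le> t powr 0" using assms False by (intro powr_mono) auto
  moreover have "0 < 1 / t" using assms by simp
  moreover have "t powr 0 = 1" using assms by simp
  ultimately show ?thesis by linarith
qed

context admissible_parameters
begin

lemma critical_balance:
  assumes K: "1 \<le> K" and crit: "\<forall>k\<le>K. g K x k = 0" and k: "k \<le> K"
  shows "dens K x k powr (\<alpha> + 1/2) - dens K x (k + 1) powr (\<alpha> + 1/2)
     = Lambda \<alpha> lam / Theta \<alpha> * mesh K * x k"
proof -
  have "Theta \<alpha> > 0" using Theta_pos[of \<alpha>] \<alpha>1 by simp
  moreover have "mesh K > 0" using mesh_pos[OF K] .
  moreover have "Theta \<alpha> * ((dens K x (k + 1) powr (\<alpha> + 1/2) - dens K x k powr (\<alpha> + 1/2)) / mesh K) + Lambda \<alpha> lam * x k = 0"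
    using crit k by (simp add: entropy_grad_def)
  ultimately show ?thesis by (simp add: divide_simps) (simp add: algebra_simps)
qed

text \<open>The first and the last balance equation locate \<open>0\<close> between the end points; then \<open>right_end_bound\<close> applies to
the grid and to its reflection.\<close>

lemma critical_bounded:
  assumes "1/2 < \<alpha>"
  shows "\<exists>R>0. \<forall>K\<ge>1. \<forall>x. strict_mono_on {0..K} x \<longrightarrow> (\<forall>k\<le>K. g K x k = 0) \<longrightarrow> (\<forall>k\<le>K. \<bar>x k\<bar> \<le> R)"
proof -
  define p where "p = \<alpha> + 1/2"
  define \<kappa> where "\<kappa> = Lambda \<alpha> lam / Theta \<alpha>"
  define R where "R = 1 + \<kappa> powr (- 1 / p) * p / (p - 1)"
  have p: "1 < p" using assms by (simp add: p_def)
  have \<kappa>: "0 < \<kappa>" using Lambda_pos[of \<alpha> lam] Theta_pos[of \<alpha>] \<alpha>1 lam by (simp add: \<kappa>_def)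
  have R: "0 < R" unfolding R_def using p \<kappa> by (intro add_pos_nonneg divide_nonneg_pos mult_nonneg_nonneg) auto
  have "\<bar>x k\<bar> \<le> R" if K: "1 \<le> K" and x: "strict_mono_on {0..K} x" and crit: "\<forall>k\<le>K. g K x k = 0" and k: "k \<le> K" for K x k
  proof -
    let ?z = "dens K x"
    have d: "0 < mesh K" "mesh K * real K = 1" using mesh_pos[OF K] mesh_times[OF K] by auto
    have bal: "?z j powr p - ?z (j + 1) powr p = \<kappa> * mesh K * x j" if "j \<le> K" for j
      using critical_balance[OF K crit that] by (simp add: p_def \<kappa>_def)
    have zpos: "0 < ?z j" if "j \<in> {1..K}" for j using dens_pos[OF x that] .
    have "- (?z (Suc 0) powr p) = \<kappa> * mesh K * x 0" using bal[of 0] by simp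
    moreover have "0 < ?z (Suc 0) powr p" using zpos[of "Suc 0"] K by simp
    ultimately have "0 < - (\<kappa> * mesh K * x 0)" by linarith
    then have x0: "x 0 < 0" using \<kappa> d by (simp add: mult_less_0_iff zero_less_mult_iff)
    have "?z K powr p = \<kappa> * mesh K * x K" using bal[of K] by simp
    moreover have "0 < ?z K powr p" using zpos[of K] K by simp
    ultimately have "0 < \<kappa> * mesh K * x K" by linarith
    then have xK: "0 < x K" by (rule zero_less_mult_pos) (use \<kappa> d in simp)
    have right: "x K \<le> R"
      unfolding R_def
    proof (rule right_end_bound[OF p \<kappa> d x])
      show "?z j powr p - ?z (j + 1) powr p = \<kappa> * mesh K * x j" if "j \<in> {1..K}" for j
        using that by (intro bal) simp
    qed (use x0 zpos dens_times_step[OF x] in auto)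
    \<comment> \<open>Reflection of the grid at the origin.\<close>
    define x' where "x' = (\<lambda>j. - x (K - j))"
    define z' where "z' = (\<lambda>j. ?z (K + 1 - j))"
    have "x' K \<le> R"
      unfolding R_def
    proof (rule right_end_bound[OF p \<kappa> d])
      show "strict_mono_on {0..K} x'"
        using x by (auto simp: strict_mono_on_def x'_def)
      show "x' 0 \<le> 1" using xK by (simp add: x'_def)
      show "z' (K + 1) = 0" by (simp add: z'_def)
      fix j assume j: "j \<in> {1..K}"
      then have j': "K + 1 - j \<in> {1..K}" "Suc K - j - 1 = K - j" "K - (j - 1) = Suc K - j" "Suc (K - j) = Suc K - j" by auto
      show "0 < z' j" unfolding z'_def using zpos[OF j'(1)] .
      show "z' j * (x' j - x' (j - 1)) = mesh K"
        using dens_times_step[OF x j'(1)] j' by (simp add: z'_def x'_def)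
      show "z' j powr p - z' (j + 1) powr p = \<kappa> * mesh K * x' j"
        using bal[of "K - j"] j' by (simp add: z'_def x'_def)
    qed
    then have left: "- R \<le> x 0" by (simp add: x'_def)
    have "x 0 \<le> x k" "x k \<le> x K"
      using strict_mono_on_leD[OF x, of 0 k] strict_mono_on_leD[OF x, of k K] k by auto
    then show ?thesis using left right by linarith
  qed
  then show ?thesis using R by blast
qed

text \<open>These are the two quantities by which the constant in the \<open>L\<^sup>1\<close> estimate could depend on \<open>K\<close>. For \<open>\<alpha> = 1/2\<close> the balance
equation is linear in the density and the second sum is the second moment of the grid, which is computed by
testing the equation with the grid itself. For \<open>\<alpha> > 1/2\<close> the weights \<open>z powr -(\<alpha> - 1/2)\<close>, and their squares, are at
most \<open>1 + 1 / z\<close>, and \<open>1 / z\<close> times the mesh size is a cell width, so both sums are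
bounded in terms of the interval that contains the grid.\<close>

lemma critical_weights_bounded:
  "\<exists>C>0. \<forall>K\<ge>1. \<forall>x. strict_mono_on {0..K} x \<longrightarrow> (\<forall>k\<le>K. g K x k = 0) \<longrightarrow>
     mesh K * (\<Sum>k=1..K. dens K x k powr (- (\<alpha> - 1/2))) \<le> C \<and>
     mesh K * (\<Sum>k=0..K. ((dens K x (k + 1) - dens K x k) / mesh K)\<^sup>2) \<le> C"
proof (cases "\<alpha> = 1/2")
  case True
  define \<kappa> where "\<kappa> = Lambda \<alpha> lam / Theta \<alpha>"
  have T: "0 < Theta \<alpha>" "0 < Lambda \<alpha> lam" using Lambda_pos[of \<alpha> lam] Theta_pos[of \<alpha>] \<alpha>1 lam by auto
  then have \<kappa>: "0 < \<kappa>" by (simp add: \<kappa>_def)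
  have "mesh K * (\<Sum>k=1..K. dens K x k powr (- (\<alpha> - 1/2))) \<le> 1 + \<kappa> \<and>
     mesh K * (\<Sum>k=0..K. ((dens K x (k + 1) - dens K x k) / mesh K)\<^sup>2) \<le> 1 + \<kappa>"
    if K: "1 \<le> K" and x: "strict_mono_on {0..K} x" and crit: "\<forall>k\<le>K. g K x k = 0" for K x
  proof
    have d: "0 < mesh K" "mesh K * real K = 1" using mesh_pos[OF K] mesh_times[OF K] by auto
    have "(\<Sum>k=1..K. dens K x k powr (- (\<alpha> - 1/2))) = (\<Sum>k=1..K. 1)"
    proof (intro sum.cong refl)
      fix k assume "k \<in> {1..K}"
      then have "0 < dens K x k" using dens_pos[OF x] by blast
      moreover have "- (\<alpha> - 1/2) = 0" using True by simp
      ultimately show "dens K x k powr (- (\<alpha> - 1/2)) = 1" by (metis less_irrefl powr_zero_eq_one)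
    qed
    then show "mesh K * (\<Sum>k=1..K. dens K x k powr (- (\<alpha> - 1/2))) \<le> 1 + \<kappa>"
      using d \<kappa> by simp
    have p1: "\<alpha> + 1/2 = 1" using True by simp
    have bal: "dens K x (k + 1) - dens K x k = - (\<kappa> * mesh K * x k)" if "k \<le> K" for k
      using critical_balance[OF K crit that] dens_nonneg[OF x] unfolding p1 \<kappa>_def by simp
    have "\<kappa> * mesh_inner K x x = - (\<Sum>k=0..K. (dens K x (k + 1) - dens K x k) * x k)"
      unfolding mesh_inner_def sum_distrib_left sum_negf[symmetric] using bal by (intro sum.cong refl) simp
    also have "\<dots> = (\<Sum>k=1..K. dens K x k * (x k - x (k - 1)))"
      by (subst summation_by_parts) auto
    also have "\<dots> = (\<Sum>k=1..K. mesh K)"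
      by (intro sum.cong refl dens_times_step x)
    finally have second_moment: "\<kappa> * mesh_inner K x x = 1" using d by (simp add: mult.commute)
    have "mesh K * (\<Sum>k=0..K. ((dens K x (k + 1) - dens K x k) / mesh K)\<^sup>2) = mesh K * (\<Sum>k=0..K. \<kappa>\<^sup>2 * (x k * x k))"
      using bal d by (intro arg_cong2[where f="(*)"] sum.cong refl) (simp add: power2_eq_square)
    also have "\<dots> = \<kappa> * (\<kappa> * mesh_inner K x x)"
      by (simp add: mesh_inner_def sum_distrib_left power2_eq_square mult_ac)
    finally show "mesh K * (\<Sum>k=0..K. ((dens K x (k + 1) - dens K x k) / mesh K)\<^sup>2) \<le> 1 + \<kappa>"
      using second_moment by simp
  qed
  then show ?thesis using \<kappa> by (intro exI[of _ "1 + \<kappa>"]) auto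
next
  case False
  define \<beta> where "\<beta> = \<alpha> - 1/2"
  define \<kappa> where "\<kappa> = Lambda \<alpha> lam / Theta \<alpha>"
  have \<beta>: "0 \<le> \<beta>" "2 * \<beta> \<le> 1" "\<alpha> + 1/2 = \<beta> + 1" using \<alpha>1 \<alpha>2 by (auto simp: \<beta>_def)
  have T: "0 < Theta \<alpha>" "0 < Lambda \<alpha> lam" using Lambda_pos[of \<alpha> lam] Theta_pos[of \<alpha>] \<alpha>1 lam by auto
  then have \<kappa>: "0 < \<kappa>" by (simp add: \<kappa>_def)
  obtain R where R: "0 < R" and bdd: "\<And>K x k. 1 \<le> K \<Longrightarrow> strict_mono_on {0..K} x \<Longrightarrow> (\<forall>k\<le>K. g K x k = 0) \<Longrightarrow> k \<le> K \<Longrightarrow> \<bar>x k\<bar> \<le> R"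
    using critical_bounded False \<alpha>1 by force
  define C where "C = 1 + 2 * R + (\<kappa> * R)\<^sup>2 * (2 + 4 * R)"
  have C_part: "0 \<le> (\<kappa> * R)\<^sup>2 * (2 + 4 * R)" using R by simp
  have "mesh K * (\<Sum>k=1..K. dens K x k powr (- (\<alpha> - 1/2))) \<le> C \<and>
     mesh K * (\<Sum>k=0..K. ((dens K x (k + 1) - dens K x k) / mesh K)\<^sup>2) \<le> C"
    if K: "1 \<le> K" and x: "strict_mono_on {0..K} x" and crit: "\<forall>k\<le>K. g K x k = 0" for K x
  proof
    let ?z = "dens K x"
    have d: "0 < mesh K" "mesh K * real K = 1" using mesh_pos[OF K] mesh_times[OF K] by auto
    have width: "mesh K * (1 / ?z k) = x k - x (k - 1)" if "k \<in> {1..K}" for k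
      using dens_times_step[OF x that] dens_pos[OF x that] by (simp add: field_simps)
    have total: "(\<Sum>k=1..N. x k - x (k - 1)) = x N - x 0" for N
      by (induction N) auto
    have len: "x K - x 0 \<le> 2 * R" "x 1 - x 0 \<le> 2 * R"
      using bdd[OF K x crit, of 0] bdd[OF K x crit, of K] bdd[OF K x crit, of 1] K by auto
    have "mesh K * (\<Sum>k=1..K. ?z k powr (- \<beta>)) \<le> (\<Sum>k=1..K. mesh K * (1 + 1 / ?z k))"
      unfolding sum_distrib_left using d \<beta> dens_pos[OF x]
      by (intro sum_mono mult_left_mono powr_minus_le) auto
    also have "\<dots> = (\<Sum>k=1..K. mesh K + (x k - x (k - 1)))"
      using width by (intro sum.cong refl) (simp only: distrib_left mult_1_right)
    also have "\<dots> = 1 + (x K - x 0)" using d total[of K] by (simp add: sum.distrib mult.commute)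
    finally show "mesh K * (\<Sum>k=1..K. ?z k powr (- (\<alpha> - 1/2))) \<le> C"
      using len C_part by (simp add: \<beta>_def[symmetric] C_def)
    \<comment> \<open>\<open>e k\<close> is the width of a cell adjacent to the point \<open>k\<close>; the first point has only the cell to its right.\<close>
    define e where "e = (\<lambda>k. if k = 0 then x 1 - x 0 else x k - x (k - 1))"
    have jump: "mesh K * ((?z (k + 1) - ?z k) / mesh K)\<^sup>2 \<le> (\<kappa> * R)\<^sup>2 * (mesh K + e k)" if k: "k \<le> K" for k
    proof -
      let ?m = "max (?z (k + 1)) (?z k)"
      define j where "j = (if k = 0 then 1 else k)"
      have j: "j \<in> {1..K}" "?z j \<le> ?m" "e k = x j - x (j - 1)" using k K by (auto simp: j_def e_def)
      have m: "0 < ?m" using j dens_pos[OF x j(1)] by linarith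
      have "\<bar>?z (k + 1) - ?z k\<bar> * ?m powr \<beta> \<le> \<bar>?z (k + 1) powr (\<beta> + 1) - ?z k powr (\<beta> + 1)\<bar>"
        using dens_nonneg[OF x] \<beta> by (intro abs_diff_le_powr_diff) auto
      also have "\<dots> = \<kappa> * mesh K * \<bar>x k\<bar>"
      proof -
        have "?z (k + 1) powr (\<beta> + 1) - ?z k powr (\<beta> + 1) = - (\<kappa> * mesh K * x k)"
          using critical_balance[OF K crit k] unfolding \<beta>(3) \<kappa>_def by linarith
        then show ?thesis using \<kappa> d by (simp add: abs_mult)
      qed
      also have "\<dots> \<le> \<kappa> * mesh K * R" using bdd[OF K x crit k] \<kappa> d by (intro mult_left_mono) auto
      finally have "\<bar>?z (k + 1) - ?z k\<bar> \<le> \<kappa> * mesh K * R * ?m powr (- \<beta>)"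
        using m by (simp add: powr_minus field_simps)
      then have "\<bar>(?z (k + 1) - ?z k) / mesh K\<bar> \<le> \<kappa> * R * ?m powr (- \<beta>)"
        using d by (simp add: pos_divide_le_eq mult_ac)
      then have "\<bar>(?z (k + 1) - ?z k) / mesh K\<bar>\<^sup>2 \<le> (\<kappa> * R * ?m powr (- \<beta>))\<^sup>2"
        by (intro power_mono) auto
      also have "\<dots> = (\<kappa> * R)\<^sup>2 * ?m powr (- (2 * \<beta>))"
        using m by (simp add: power_mult_distrib powr_add[symmetric] power2_eq_square)
      also have "\<dots> \<le> (\<kappa> * R)\<^sup>2 * (1 + 1 / ?m)"
        using m \<beta> by (intro mult_left_mono powr_minus_le) auto
      also have "\<dots> \<le> (\<kappa> * R)\<^sup>2 * (1 + 1 / ?z j)"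
        using m j dens_pos[OF x j(1)] by (intro mult_left_mono add_left_mono divide_left_mono) auto
      finally have "mesh K * ((?z (k + 1) - ?z k) / mesh K)\<^sup>2 \<le> mesh K * ((\<kappa> * R)\<^sup>2 * (1 + 1 / ?z j))"
        using d unfolding power2_abs by (intro mult_left_mono) simp_all
      also have "\<dots> = (\<kappa> * R)\<^sup>2 * (mesh K + mesh K * (1 / ?z j))" by (simp add: algebra_simps)
      finally show ?thesis unfolding width[OF j(1)] j(3) .
    qed
    have "mesh K * (\<Sum>k=0..K. ((?z (k + 1) - ?z k) / mesh K)\<^sup>2) \<le> (\<Sum>k=0..K. (\<kappa> * R)\<^sup>2 * (mesh K + e k))"
      unfolding sum_distrib_left by (intro sum_mono jump) simp
    also have "\<dots> = (\<kappa> * R)\<^sup>2 * ((\<Sum>k=0..K. mesh K) + (\<Sum>k=0..K. e k))"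
      by (simp only: sum_distrib_left[symmetric] sum.distrib)
    also have "\<dots> \<le> (\<kappa> * R)\<^sup>2 * (2 + 4 * R)"
    proof (intro mult_left_mono add_mono)
      have "mesh K \<le> 1" using K by (simp add: mesh_def)
      then show "(\<Sum>k=0..K. mesh K) \<le> 2" using d by (simp add: algebra_simps)
      have "(\<Sum>k=0..K. e k) = e 0 + (\<Sum>k=1..K. e k)" by (simp add: sum.atLeast_Suc_atMost)
      also have "(\<Sum>k=1..K. e k) = (\<Sum>k=1..K. x k - x (k - 1))" by (intro sum.cong) (auto simp: e_def)
      finally show "(\<Sum>k=0..K. e k) \<le> 4 * R" using len total[of K] by (simp add: e_def)
    qed auto
    also have "\<dots> \<le> C" using R by (simp add: C_def)
    finally show "mesh K * (\<Sum>k=0..K. ((?z (k + 1) - ?z k) / mesh K)\<^sup>2) \<le> C" .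
  qed
  moreover have "0 < C" unfolding C_def using R C_part by linarith
  ultimately show ?thesis by blast
qed

end

section \<open>The entropy gap controls the distance of the densities\<close>

text \<open>Let \<open>v\<close> take the cell values of the second density on the cells of the first grid. On each cell the first density and \<open>v\<close>
differ by a constant, and \<open>v\<close> differs from the second density only between corresponding grid points, by the jump
there. Only cells on which \<open>v\<close> is smaller enter the first sum on the right: the total masses of \<open>v\<close> and of the second
density differ by at most the second sum, so the excess of \<open>v\<close> is controlled by its deficit. This matters because
the entropy is quadratic only in the deficit.\<close>

lemma dens_fun_L1_le:
  assumes K: "1 \<le> K" and x: "strict_mono_on {0..K} x" and y: "strict_mono_on {0..K} y"
  shows "(LINT t|lborel. \<bar>dens_fun K x t - dens_fun K y t\<bar>)
    \<le> 2 * (mesh K * (\<Sum>k=1..K. max 0 (1 - dens K y k / dens K x k)))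
      + 2 * (\<Sum>k=0..K. \<bar>dens K y (k + 1) - dens K y k\<bar> * \<bar>x k - y k\<bar>)"
proof -
  let ?a = "dens K x" and ?b = "dens K y"
  let ?I = "\<lambda>x k. indicator {x (k - 1)<..x k} :: real \<Rightarrow> real"
  let ?J = "\<lambda>k. indicator {min (x k) (y k)<..max (x k) (y k)} :: real \<Rightarrow> real"
  have u: "dens_fun K z t = (\<Sum>k=1..K. dens K z k * ?I z k t)" for z t
    unfolding dens_fun_def by (intro sum.cong refl) (simp add: dens_eq)
  have I: "has_bochner_integral lborel (indicator {l<..r} :: real \<Rightarrow> real) (r - l)" if "l \<le> r" for l r
    using has_bochner_integral_real_indicator[of "{l<..r}" lborel] that by simp
  have int_u: "integrable lborel (dens_fun K z)" if "strict_mono_on {0..K} z" for z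
    unfolding u[abs_def] using I grid_step[OF that]
    by (intro Bochner_Integration.integrable_sum integrable_mult_right) (fastforce simp: has_bochner_integral_iff)
  define G where "G = (\<lambda>t. (\<Sum>k=1..K. \<bar>?a k - ?b k\<bar> * ?I x k t) + (\<Sum>k=0..K. \<bar>?b (k + 1) - ?b k\<bar> * ?J k t))"
  let ?B = "\<Sum>k=0..K. \<bar>?b (k + 1) - ?b k\<bar> * \<bar>x k - y k\<bar>"
  have "has_bochner_integral lborel G ((\<Sum>k=1..K. \<bar>?a k - ?b k\<bar> * (x k - x (k - 1)))
     + (\<Sum>k=0..K. \<bar>?b (k + 1) - ?b k\<bar> * (max (x k) (y k) - min (x k) (y k))))"
    unfolding G_def
    by (intro has_bochner_integral_add has_bochner_integral_sum has_bochner_integral_mult_right I)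
      (use grid_step[OF x] in \<open>auto intro: less_imp_le\<close>)
  moreover have "(\<Sum>k=0..K. \<bar>?b (k + 1) - ?b k\<bar> * (max (x k) (y k) - min (x k) (y k))) = ?B"
    by (intro sum.cong refl) (auto simp: max_def min_def)
  ultimately have G: "has_bochner_integral lborel G ((\<Sum>k=1..K. \<bar>?a k - ?b k\<bar> * (x k - x (k - 1))) + ?B)"
    by simp
  have pointwise: "\<bar>dens_fun K x t - dens_fun K y t\<bar> \<le> G t" for t
  proof -
    \<comment> \<open>Indicators of cells are differences of indicators of half lines, so summation by parts moves the differences to the densities.\<close>
    let ?V = "\<lambda>k. of_bool (t \<le> x k) - of_bool (t \<le> y k) :: real"
    have ind: "?I z k t = of_bool (t \<le> z k) - of_bool (t \<le> z (k - 1))"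
      if "strict_mono_on {0..K} z" "k \<in> {1..K}" for z k
      using grid_step[OF that] by (auto simp: indicator_def)
    have "dens_fun K x t - dens_fun K y t
        = (\<Sum>k=1..K. (?a k - ?b k) * ?I x k t) + (\<Sum>k=1..K. ?b k * (?I x k t - ?I y k t))"
      unfolding u by (simp add: algebra_simps sum.distrib sum_subtractf)
    also have "(\<Sum>k=1..K. ?b k * (?I x k t - ?I y k t)) = (\<Sum>k=1..K. ?b k * (?V k - ?V (k - 1)))"
      using ind[OF x] ind[OF y] by (intro sum.cong refl) simp
    also have "\<dots> = - (\<Sum>k=0..K. (?b (k + 1) - ?b k) * ?V k)"
      by (rule summation_by_parts) auto
    finally have "\<bar>dens_fun K x t - dens_fun K y t\<bar>
       \<le> \<bar>\<Sum>k=1..K. (?a k - ?b k) * ?I x k t\<bar> + \<bar>\<Sum>k=0..K. (?b (k + 1) - ?b k) * ?V k\<bar>"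
      by linarith
    also have "\<dots> \<le> (\<Sum>k=1..K. \<bar>(?a k - ?b k) * ?I x k t\<bar>) + (\<Sum>k=0..K. \<bar>(?b (k + 1) - ?b k) * ?V k\<bar>)"
      by (intro add_mono sum_abs)
    also have "\<dots> = G t"
      unfolding G_def
      by (intro arg_cong2[where f="(+)"] sum.cong refl) (auto simp: abs_mult indicator_def)
    finally show ?thesis .
  qed
  \<comment> \<open>\<open>|1 - r| = 2 max 0 (1 - r) + (r - 1)\<close>, where the sum of the last terms is a difference of masses.\<close>
  have cells: "\<bar>?a k - ?b k\<bar> * (x k - x (k - 1))
      = mesh K * (2 * max 0 (1 - ?b k / ?a k)) + (?b k * (x k - x (k - 1)) - mesh K)" if k: "k \<in> {1..K}" for k
  proof -
    have a: "0 < ?a k" using dens_pos[OF x k] .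
    have d: "x k - x (k - 1) = mesh K / ?a k"
      using dens_times_step[OF x k] a by (simp add: field_simps)
    have m: "mesh K > 0" using mesh_pos[OF K] .
    have "\<bar>?a k - ?b k\<bar> * (mesh K / ?a k) = mesh K * \<bar>1 - ?b k / ?a k\<bar>"
    proof -
      have "\<bar>1 - ?b k / ?a k\<bar> = \<bar>(?a k - ?b k) / ?a k\<bar>" using a by (simp add: diff_divide_distrib)
      then show ?thesis using a by simp
    qed
    also have "\<bar>1 - ?b k / ?a k\<bar> = 2 * max 0 (1 - ?b k / ?a k) + (?b k / ?a k - 1)" by (auto simp: max_def)
    finally show ?thesis unfolding d by (simp add: algebra_simps)
  qed
  have "(\<Sum>k=1..K. \<bar>?a k - ?b k\<bar> * (x k - x (k - 1)))
     = 2 * (mesh K * (\<Sum>k=1..K. max 0 (1 - ?b k / ?a k))) + (\<Sum>k=1..K. ?b k * (x k - x (k - 1)) - mesh K)"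
    by (subst sum.cong[OF refl cells]) (auto simp: sum.distrib sum_distrib_left mult_ac)
  moreover have "(\<Sum>k=1..K. ?b k * (x k - x (k - 1)) - mesh K) \<le> ?B"
  proof -
    let ?v = "\<lambda>k. x k - y k"
    have "(\<Sum>k=1..K. ?b k * (x k - x (k - 1)) - mesh K) = (\<Sum>k=1..K. ?b k * (?v k - ?v (k - 1)))"
    proof (intro sum.cong refl)
      fix k assume k: "k \<in> {1..K}"
      show "?b k * (x k - x (k - 1)) - mesh K = ?b k * (?v k - ?v (k - 1))"
        unfolding dens_times_step[OF y k, symmetric] by (simp add: algebra_simps)
    qed
    also have "\<dots> = - (\<Sum>k=0..K. (?b (k + 1) - ?b k) * ?v k)"
      by (rule summation_by_parts) auto
    also have "\<dots> \<le> \<bar>\<Sum>k=0..K. (?b (k + 1) - ?b k) * ?v k\<bar>" by simp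
    also have "\<dots> \<le> ?B" using sum_abs[of "\<lambda>k. (?b (k + 1) - ?b k) * ?v k"] by (simp add: abs_mult)
    finally show ?thesis .
  qed
  moreover have "(LINT t|lborel. \<bar>dens_fun K x t - dens_fun K y t\<bar>) \<le> (LINT t|lborel. G t)"
    using G pointwise int_u[OF x] int_u[OF y] by (intro integral_mono) (auto simp: has_bochner_integral_iff)
  ultimately show ?thesis using G by (simp add: has_bochner_integral_iff)
qed

context admissible_parameters
begin

text \<open>At the minimizer the linear term of the entropy expansion vanishes, so the entropy gap dominates both remainders. The
Cauchy--Schwarz inequality, with weights \<open>z powr \<plusminus>(\<alpha> - 1/2)\<close> in the first sum, compares them with the two sums
of \<open>dens_fun_L1_le\<close>.\<close>

lemma dens_fun_L1_le_entropy_gap: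
  "\<exists>c>0. \<forall>K\<ge>1. \<forall>x\<in>grids K.
     (LINT t|lborel. \<bar>dens_fun K x t - dens_fun K (x_min \<alpha> lam K) t\<bar>)\<^sup>2 \<le> c * (H K x - H K (x_min \<alpha> lam K))"
proof -
  obtain C where C: "0 < C" and bdd: "\<And>K x. 1 \<le> K \<Longrightarrow> strict_mono_on {0..K} x \<Longrightarrow> (\<forall>k\<le>K. g K x k = 0) \<Longrightarrow>
     mesh K * (\<Sum>k=1..K. dens K x k powr (- (\<alpha> - 1/2))) \<le> C \<and>
     mesh K * (\<Sum>k=0..K. ((dens K x (k + 1) - dens K x k) / mesh K)\<^sup>2) \<le> C"
    using critical_weights_bounded by blast
  have T: "0 < Theta \<alpha>" "0 < Lambda \<alpha> lam" using Lambda_pos[of \<alpha> lam] Theta_pos[of \<alpha>] \<alpha>1 lam by auto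
  define c where "c = 16 * C / Theta \<alpha> + 16 * C / Lambda \<alpha> lam"
  have "(LINT t|lborel. \<bar>dens_fun K x t - dens_fun K (x_min \<alpha> lam K) t\<bar>)\<^sup>2 \<le> c * (H K x - H K (x_min \<alpha> lam K))"
    if K: "1 \<le> K" and xg: "x \<in> grids K" for K x
  proof -
    define y where "y = x_min \<alpha> lam K"
    have x: "strict_mono_on {0..K} x" using xg by (simp add: grids_def)
    have y: "strict_mono_on {0..K} y" and crit: "\<forall>k\<le>K. g K y k = 0"
      using x_min_critical[OF K] by (auto simp: y_def grids_def)
    note w = bdd[OF K y crit]
    let ?b = "dens K y" and ?\<beta> = "\<alpha> - 1/2" and ?v = "\<lambda>k. x k - y k"
    let ?m = "\<lambda>k. max 0 (1 - dens K y k / dens K x k)"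
    define h where "h = H K x - H K y"
    define A where "A = mesh K * (\<Sum>k=1..K. ?m k)"
    define B where "B = (\<Sum>k=0..K. \<bar>?b (k + 1) - ?b k\<bar> * \<bar>x k - y k\<bar>)"
    define S where "S = mesh K * (\<Sum>k=1..K. ?b k powr ?\<beta> * (?m k)\<^sup>2)"
    have d: "0 < mesh K" using mesh_pos[OF K] .
    have S0: "0 \<le> S" unfolding S_def using d by (intro mult_nonneg_nonneg sum_nonneg) auto
    have "mesh_inner K (g K y) ?v = 0" using crit by (simp add: mesh_inner_def)
    then have gap: "Lambda \<alpha> lam / 2 * mesh_inner K ?v ?v + Theta \<alpha> / 2 * S \<le> h"
      using entropy_strong_convexity[OF K y x] by (simp add: S_def h_def)
    have "0 \<le> Lambda \<alpha> lam / 2 * mesh_inner K ?v ?v" "0 \<le> Theta \<alpha> / 2 * S" using T S0 mesh_inner_nonneg by auto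
    then have "Theta \<alpha> / 2 * S \<le> h" "Lambda \<alpha> lam / 2 * mesh_inner K ?v ?v \<le> h" using gap by linarith+
    then have S: "S \<le> 2 * h / Theta \<alpha>" and V: "mesh_inner K ?v ?v \<le> 2 * h / Lambda \<alpha> lam"
      using T by (auto simp: field_simps)
    have A: "A\<^sup>2 \<le> C * (2 * h / Theta \<alpha>)"
    proof -
      have m_eq: "?m k = ?b k powr (- ?\<beta> / 2) * (?b k powr (?\<beta> / 2) * ?m k)" if "k \<in> {1..K}" for k
      proof -
        have "?b k powr (- ?\<beta> / 2) * ?b k powr (?\<beta> / 2) = 1"
        proof -
          have "- ?\<beta> / 2 + ?\<beta> / 2 = 0" by linarith
          then show ?thesis using dens_pos[OF y that] by (simp only: powr_add[symmetric]) simp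
        qed
        then show ?thesis by (simp only: mult.assoc[symmetric] mult_1)
      qed
      have "(\<Sum>k=1..K. ?m k) = (\<Sum>k=1..K. ?b k powr (- ?\<beta> / 2) * (?b k powr (?\<beta> / 2) * ?m k))"
        using m_eq by (intro sum.cong refl)
      then have "A\<^sup>2 = (mesh K)\<^sup>2 * (\<Sum>k=1..K. ?b k powr (- ?\<beta> / 2) * (?b k powr (?\<beta> / 2) * ?m k))\<^sup>2"
        by (simp only: A_def power_mult_distrib)
      also have "\<dots> \<le> (mesh K)\<^sup>2 * ((\<Sum>k=1..K. (?b k powr (- ?\<beta> / 2))\<^sup>2) * (\<Sum>k=1..K. (?b k powr (?\<beta> / 2) * ?m k)\<^sup>2))"
        by (intro mult_left_mono Cauchy_Schwarz_ineq_sum) simp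
      also have "(\<Sum>k=1..K. (?b k powr (- ?\<beta> / 2))\<^sup>2) = (\<Sum>k=1..K. ?b k powr (- ?\<beta>))"
        by (intro sum.cong refl) (simp add: power2_eq_square powr_add[symmetric])
      also have "(\<Sum>k=1..K. (?b k powr (?\<beta> / 2) * ?m k)\<^sup>2) = (\<Sum>k=1..K. ?b k powr ?\<beta> * (?m k)\<^sup>2)"
      proof (intro sum.cong refl)
        fix k
        have "(?b k powr (?\<beta> / 2))\<^sup>2 = ?b k powr ?\<beta>"
          by (simp only: power2_eq_square powr_add[symmetric]) simp
        then show "(?b k powr (?\<beta> / 2) * ?m k)\<^sup>2 = ?b k powr ?\<beta> * (?m k)\<^sup>2"
          by (simp only: power_mult_distrib)
      qed
      also have "(mesh K)\<^sup>2 * ((\<Sum>k=1..K. ?b k powr (- ?\<beta>)) * (\<Sum>k=1..K. ?b k powr ?\<beta> * (?m k)\<^sup>2))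
          = (mesh K * (\<Sum>k=1..K. ?b k powr (- ?\<beta>))) * S"
        unfolding S_def by (simp only: power2_eq_square mult_ac)
      also have "\<dots> \<le> C * (2 * h / Theta \<alpha>)"
        using w S S0 C by (intro mult_mono) auto
      finally show ?thesis .
    qed
    have B: "B\<^sup>2 \<le> C * (2 * h / Lambda \<alpha> lam)"
    proof -
      have "B = mesh_inner K (\<lambda>k. \<bar>(?b (k + 1) - ?b k) / mesh K\<bar>) (\<lambda>k. \<bar>?v k\<bar>)"
        using d by (simp add: B_def mesh_inner_def sum_distrib_left)
      then have "B\<^sup>2 \<le> mesh_inner K (\<lambda>k. \<bar>(?b (k + 1) - ?b k) / mesh K\<bar>) (\<lambda>k. \<bar>(?b (k + 1) - ?b k) / mesh K\<bar>) * mesh_inner K (\<lambda>k. \<bar>?v k\<bar>) (\<lambda>k. \<bar>?v k\<bar>)"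
        using mesh_inner_cauchy by simp
      also have "mesh_inner K (\<lambda>k. \<bar>?v k\<bar>) (\<lambda>k. \<bar>?v k\<bar>) = mesh_inner K ?v ?v" by (simp add: mesh_inner_def)
      also have "mesh_inner K (\<lambda>k. \<bar>(?b (k + 1) - ?b k) / mesh K\<bar>) (\<lambda>k. \<bar>(?b (k + 1) - ?b k) / mesh K\<bar>)
          = mesh K * (\<Sum>k=0..K. ((?b (k + 1) - ?b k) / mesh K)\<^sup>2)"
        by (simp only: mesh_inner_def abs_mult_self_eq power2_eq_square)
      also have "mesh K * (\<Sum>k=0..K. ((?b (k + 1) - ?b k) / mesh K)\<^sup>2) * mesh_inner K ?v ?v \<le> C * (2 * h / Lambda \<alpha> lam)"
        using w V C mesh_inner_nonneg by (intro mult_mono) auto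
      finally show ?thesis .
    qed
    have "(LINT t|lborel. \<bar>dens_fun K x t - dens_fun K y t\<bar>)\<^sup>2 \<le> (2 * A + 2 * B)\<^sup>2"
      using dens_fun_L1_le[OF K x y] unfolding A_def B_def by (intro power_mono) auto
    also have "\<dots> \<le> 8 * A\<^sup>2 + 8 * B\<^sup>2"
      using zero_le_power2[of "A - B"] by (simp add: power2_eq_square algebra_simps)
    also have "\<dots> \<le> 8 * (C * (2 * h / Theta \<alpha>)) + 8 * (C * (2 * h / Lambda \<alpha> lam))"
      using A B by (intro add_mono mult_left_mono) auto
    also have "\<dots> = c * h" by (simp add: c_def algebra_simps)
    finally show ?thesis by (simp add: y_def h_def)
  qed
  moreover have "0 < c" unfolding c_def using C T by (intro add_pos_pos divide_pos_pos) auto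
  ultimately show ?thesis by blast
qed

end

section \<open>Exponential decay\<close>

theorem theorem2:
  fixes \<alpha> lam :: real
  assumes "1/2 \<le> \<alpha>" and "\<alpha> \<le> 1" and "lam > 0"
  shows "\<exists>c>0. \<forall>(K::nat) (\<tau>::real) (\<tau>s :: nat \<Rightarrow> real) (X :: nat \<Rightarrow> nat \<Rightarrow> real).
    1 \<le> K \<longrightarrow> 0 < \<tau> \<longrightarrow>
    (\<forall>n\<ge>1. 0 < \<tau>s n \<and> \<tau>s n \<le> \<tau>) \<longrightarrow>
    (\<forall>n. X n \<in> grids K) \<longrightarrow>
    (\<forall>n\<ge>1. is_minimizer K (step_functional \<alpha> lam K (\<tau>s n) (X (n - 1))) (X n)) \<longrightarrow>
    (\<forall>n\<ge>1.
      let decay = exp (- (2 * lam / (1 + lam * \<tau>)) * (\<Sum>j=1..n. \<tau>s j));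
          xmin = x_min \<alpha> lam K;
          Hmin = entropy \<alpha> lam K xmin;
          Fmin = information \<alpha> lam K xmin
      in entropy \<alpha> lam K (X n) - Hmin \<le> (entropy \<alpha> lam K (X 0) - Hmin) * decay \<and>
         information \<alpha> lam K (X n) - Fmin \<le> (information \<alpha> lam K (X 0) - Fmin) * decay \<and>
         (LINT y|lborel. \<bar>dens_fun K (X n) y - dens_fun K xmin y\<bar>)\<^sup>2
           \<le> c * (entropy \<alpha> lam K (X 0) - Hmin) * decay)"
proof -
  interpret admissible_parameters \<alpha> lam using assms by unfold_locales
  obtain c where c: "0 < c" and L1: "\<And>K x. 1 \<le> K \<Longrightarrow> x \<in> grids K \<Longrightarrow>
     (LINT t|lborel. \<bar>dens_fun K x t - dens_fun K (x_min \<alpha> lam K) t\<bar>)\<^sup>2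
       \<le> c * (entropy \<alpha> lam K x - entropy \<alpha> lam K (x_min \<alpha> lam K))"
    using dens_fun_L1_le_entropy_gap by blast
  show ?thesis
  proof (intro exI[of _ c] conjI c allI impI, unfold Let_def)
    fix K :: nat and \<tau> :: real and \<tau>s :: "nat \<Rightarrow> real" and X :: "nat \<Rightarrow> nat \<Rightarrow> real" and n :: nat
    assume K: "1 \<le> K" and \<tau>s: "\<forall>n\<ge>1. 0 < \<tau>s n \<and> \<tau>s n \<le> \<tau>" and X: "\<forall>n. X n \<in> grids K"
      and min: "\<forall>n\<ge>1. is_minimizer K (step_functional \<alpha> lam K (\<tau>s n) (X (n - 1))) (X n)"
    let ?h = "\<lambda>n. entropy \<alpha> lam K (X n) - entropy \<alpha> lam K (x_min \<alpha> lam K)"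
    let ?f = "\<lambda>n. information \<alpha> lam K (X n) - information \<alpha> lam K (x_min \<alpha> lam K)"
    let ?decay = "exp (- (2 * lam / (1 + lam * \<tau>)) * (\<Sum>j=1..n. \<tau>s j))"
    have prox: "\<forall>z\<in>grids K. information \<alpha> lam K (X n) + mesh_inner K (\<lambda>k. X n k - X (n - 1) k) (\<lambda>k. X n k - X (n - 1) k) / (2 * \<tau>s n)
        \<le> information \<alpha> lam K z + mesh_inner K (\<lambda>k. z k - X (n - 1) k) (\<lambda>k. z k - X (n - 1) k) / (2 * \<tau>s n)" if "1 \<le> n" for n
      using min that by (simp add: is_minimizer_def is_arg_min_linorder step_functional_def norm_mesh_square add.commute)
    have h: "?h n \<le> ?h 0 * ?decay"
      using \<tau>s entropy_step[OF K _ X[rule_format] X[rule_format] prox] entropy_min_le[OF K X[rule_format]]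
      by (intro discrete_decay lam) auto
    have f: "?f n \<le> ?f 0 * ?decay"
      using \<tau>s information_step[OF K _ X[rule_format] X[rule_format] prox] information_min_le[OF K X[rule_format]]
      by (intro discrete_decay lam) auto
    have "(LINT y|lborel. \<bar>dens_fun K (X n) y - dens_fun K (x_min \<alpha> lam K) y\<bar>)\<^sup>2 \<le> c * ?h n"
      by (rule L1[OF K X[rule_format]])
    also have "\<dots> \<le> c * (?h 0 * ?decay)" using h c by (intro mult_left_mono) auto
    finally show "?h n \<le> ?h 0 * ?decay \<and> ?f n \<le> ?f 0 * ?decay \<and>
      (LINT y|lborel. \<bar>dens_fun K (X n) y - dens_fun K (x_min \<alpha> lam K) y\<bar>)\<^sup>2 \<le> c * ?h 0 * ?decay"
      using h f by (simp only: mult.assoc)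
  qed
qed

end
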